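(* Let $F$ be a cellular automaton on $A^{\mathbb Z}$ and $\mu$ a $\sigma$-ergodic, $F$-invariant Borel probability measure. Then for every pair of reals $v=(v^+,v^-)$ with $v^\pm\ge0$, $$h_\mu(F)\ge h_\mu(\sigma)\,(v^++v^-)\,M_\mu(v).$$
   Context: $A$ is a finite alphabet and $\sigma(x)_i=x_{i+1}$. $F$ is a cellular automaton of radius $r$, i.e. $F(x)_i=f(x_{i-r},\dots,x_{i+r})$. $h_\mu$ denotes measure-theoretic entropy. For $p\ge0$: ${}^{\{n\}}\alpha_p^F(x)=\{y:F^i(y)_j=F^i(x)_j\ \forall0\le i\le n,\ |j|\le p\}$. A speed $G$ consists of functions $g^\pm_n:A^{\mathbb Z}\to\mathbb N$, nondecreasing in $n$, with $g^+_n+g^-_n\to\infty$. Set $|G_n(x)|=g^+_n(x)+g^-_n(x)+1$ and $J_n(x)=\{j:-g^+_n(x)-p\le j\le g^-_n(x)+p\}$. For $y\in A^{\mathbb Z}$, ${}^{G_n(x)}\alpha_p^\sigma(y)=\{z:z_j=y_j\ \forall j\in J_n(x)\}$. For $0<\delta<1$, $\eta_{n,\delta}$ is the infimum of $\varepsilon>0$ such that some measurable $S$ with $\mu(S)\ge1-\delta$ satisfies $$\Big|\frac{-\log\mu({}^{G_i(x)}\alpha_p^\sigma(x))}{|G_i(x)|}-h_\mu(\sigma)\Big|<\varepsilon\quad\text{for all } x\in S,\ i\ge n.$$ $X^G_{n,\delta,p}$ is the set of $x$ for which this quantity, taken with $i=n$, is $\le\eta_{n,\delta}$. $\langle T^G_{n,p}(x)\rangle=\{z|_{J_n(x)}:z\in{}^{\{n\}}\alpha_p^F(x)\}$,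 and $T^G_{n,p}(x)$ is the union of the cylinders $\{z:z|_{J_n(x)}=w\}$ over these $w$. $T^G_{n,\delta,p}(x)=T^G_{n,p}(x)\cap X^G_{n,\delta,p}$ and $\langle T^G_{n,\delta,p}(x)\rangle=\{z|_{J_n(x)}:z\in T^G_{n,\delta,p}(x)\}$. Density flow: $$M_{n,p,\delta}(G)=\int\Big(1-\frac{\log\#\langle T^G_{n,\delta,p}(x)\rangle}{-\log\mu({}^{G_n(x)}\alpha_p^\sigma(x))}\Big)d\mu(x),\qquad M_\mu(G)=\sup_p\limsup_{\delta\to0}\limsup_{n\to\infty}M_{n,p,\delta}(G).$$ For reals $v^\pm\ge0$, $M_\mu(v)$ denotes $M_\mu(G)$ for $g^\pm_n=\lceil v^\pm n\rceil$. *)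

theory Defs
  imports "HOL-Probability.Probability"
begin

type_synonym 'a config = "int \<Rightarrow> 'a"

text \<open>The product (= Borel, since A is finite discrete and Z countable) sigma algebra on A^Z.\<close>
definition config_space :: "'a config measure" where
  "config_space = Pi\<^sub>M UNIV (\<lambda>_::int. count_space (UNIV::'a set))"

definition shift :: "'a config \<Rightarrow> 'a config" where
  "shift x = (\<lambda>i. x (i + 1))"

definition ca :: "nat \<Rightarrow> ('a list \<Rightarrow> 'a) \<Rightarrow> 'a config \<Rightarrow> 'a config" where
  "ca r f x = (\<lambda>i. f (map (\<lambda>k. x (i + k)) [- int r .. int r]))"

definition measure_preserving :: "'b measure \<Rightarrow> ('b \<Rightarrow> 'b) \<Rightarrow> bool" where
  "measure_preserving M T \<longleftrightarrow> T \<in> measurable M M \<and> distr M M T = M"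

definition ergodic :: "'b measure \<Rightarrow> ('b \<Rightarrow> 'b) \<Rightarrow> bool" where
  "ergodic M T \<longleftrightarrow> measure_preserving M T \<and>
     (\<forall>A \<in> sets M. T -` A \<inter> space M = A \<longrightarrow> measure M A = 0 \<or> measure M A = 1)"

text \<open>Finite measurable partitions, represented by measurable maps with finite range
  (the partition is the family of nonempty fibres).\<close>
definition fin_partition :: "'b measure \<Rightarrow> ('b \<Rightarrow> nat) \<Rightarrow> bool" where
  "fin_partition M \<xi> \<longleftrightarrow> \<xi> \<in> measurable M (count_space UNIV) \<and> finite (\<xi> ` space M)"

definition part_entropy :: "'b measure \<Rightarrow> ('b \<Rightarrow> 'c) \<Rightarrow> real" where
  "part_entropy M \<eta> = - (\<Sum>v \<in> \<eta> ` space M.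
      measure M (\<eta> -` {v} \<inter> space M) * ln (measure M (\<eta> -` {v} \<inter> space M)))"

text \<open>The join of T^{-i} xi for i < n corresponds to the itinerary map.\<close>
definition itinerary :: "('b \<Rightarrow> 'b) \<Rightarrow> ('b \<Rightarrow> nat) \<Rightarrow> nat \<Rightarrow> 'b \<Rightarrow> nat list" where
  "itinerary T \<xi> n x = map (\<lambda>i. \<xi> ((T ^^ i) x)) [0..<n]"

definition entropy_rel :: "'b measure \<Rightarrow> ('b \<Rightarrow> 'b) \<Rightarrow> ('b \<Rightarrow> nat) \<Rightarrow> real" where
  "entropy_rel M T \<xi> = lim (\<lambda>n. part_entropy M (itinerary T \<xi> (Suc n)) / real (Suc n))"

definition ks_entropy :: "'b measure \<Rightarrow> ('b \<Rightarrow> 'b) \<Rightarrow> ereal" where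
  "ks_entropy M T = (SUP \<xi> \<in> {\<xi>. fin_partition M \<xi>}. ereal (entropy_rel M T \<xi>))"

text \<open>A speed G is given by gp n x = g^+_n(x) and gm n x = g^-_n(x).\<close>

definition Gsize :: "(nat \<Rightarrow> 'a config \<Rightarrow> nat) \<Rightarrow> (nat \<Rightarrow> 'a config \<Rightarrow> nat) \<Rightarrow> nat \<Rightarrow> 'a config \<Rightarrow> nat" where
  "Gsize gp gm n x = gp n x + gm n x + 1"

definition Jset :: "(nat \<Rightarrow> 'a config \<Rightarrow> nat) \<Rightarrow> (nat \<Rightarrow> 'a config \<Rightarrow> nat) \<Rightarrow> nat \<Rightarrow> nat \<Rightarrow> 'a config \<Rightarrow> int set" where
  "Jset gp gm p n x = {j. - int (gp n x) - int p \<le> j \<and> j \<le> int (gm n x) + int p}"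

definition cyl :: "int set \<Rightarrow> 'a config \<Rightarrow> 'a config set" where
  "cyl J y = {z. \<forall>j \<in> J. z j = y j}"

definition Galpha :: "(nat \<Rightarrow> 'a config \<Rightarrow> nat) \<Rightarrow> (nat \<Rightarrow> 'a config \<Rightarrow> nat) \<Rightarrow> nat \<Rightarrow> nat \<Rightarrow> 'a config \<Rightarrow> 'a config set" where
  "Galpha gp gm p n x = cyl (Jset gp gm p n x) x"

definition info_rate :: "'a config measure \<Rightarrow> (nat \<Rightarrow> 'a config \<Rightarrow> nat) \<Rightarrow> (nat \<Rightarrow> 'a config \<Rightarrow> nat) \<Rightarrow> nat \<Rightarrow> nat \<Rightarrow> 'a config \<Rightarrow> real" where
  "info_rate \<mu> gp gm p n x = - ln (measure \<mu> (Galpha gp gm p n x)) / real (Gsize gp gm n x)"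

text \<open>eta_{n,delta}: infimum (in the extended reals; +infinity if no epsilon works).\<close>
definition eta :: "'a config measure \<Rightarrow> (nat \<Rightarrow> 'a config \<Rightarrow> nat) \<Rightarrow> (nat \<Rightarrow> 'a config \<Rightarrow> nat) \<Rightarrow> nat \<Rightarrow> nat \<Rightarrow> real \<Rightarrow> ereal" where
  "eta \<mu> gp gm p n \<delta> = Inf (ereal ` {\<epsilon>::real. \<epsilon> > 0 \<and>
     (\<exists>S \<in> sets \<mu>. measure \<mu> S \<ge> 1 - \<delta> \<and>
        (\<forall>x \<in> S. \<forall>i \<ge> n. \<bar>info_rate \<mu> gp gm p i x - real_of_ereal (ks_entropy \<mu> shift)\<bar> < \<epsilon>))})"

definition Xset :: "'a config measure \<Rightarrow> (nat \<Rightarrow> 'a config \<Rightarrow> nat) \<Rightarrow> (nat \<Rightarrow> 'a config \<Rightarrow> nat) \<Rightarrow> nat \<Rightarrow> nat \<Rightarrow> real \<Rightarrow> 'a config set" where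
  "Xset \<mu> gp gm p n \<delta> = {x. ereal \<bar>info_rate \<mu> gp gm p n x - real_of_ereal (ks_entropy \<mu> shift)\<bar> \<le> eta \<mu> gp gm p n \<delta>}"

definition Falpha :: "('a config \<Rightarrow> 'a config) \<Rightarrow> nat \<Rightarrow> nat \<Rightarrow> 'a config \<Rightarrow> 'a config set" where
  "Falpha F p n x = {y. \<forall>i \<le> n. \<forall>j. \<bar>j\<bar> \<le> int p \<longrightarrow> (F ^^ i) y j = (F ^^ i) x j}"

text \<open>Words on J are represented as functions restricted to J.\<close>
definition Twords :: "('a config \<Rightarrow> 'a config) \<Rightarrow> (nat \<Rightarrow> 'a config \<Rightarrow> nat) \<Rightarrow> (nat \<Rightarrow> 'a config \<Rightarrow> nat) \<Rightarrow> nat \<Rightarrow> nat \<Rightarrow> 'a config \<Rightarrow> 'a config set" where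
  "Twords F gp gm p n x = (\<lambda>z. restrict z (Jset gp gm p n x)) ` Falpha F p n x"

definition Tset :: "('a config \<Rightarrow> 'a config) \<Rightarrow> (nat \<Rightarrow> 'a config \<Rightarrow> nat) \<Rightarrow> (nat \<Rightarrow> 'a config \<Rightarrow> nat) \<Rightarrow> nat \<Rightarrow> nat \<Rightarrow> 'a config \<Rightarrow> 'a config set" where
  "Tset F gp gm p n x = {z. restrict z (Jset gp gm p n x) \<in> Twords F gp gm p n x}"

definition Tdelta_words :: "'a config measure \<Rightarrow> ('a config \<Rightarrow> 'a config) \<Rightarrow> (nat \<Rightarrow> 'a config \<Rightarrow> nat) \<Rightarrow> (nat \<Rightarrow> 'a config \<Rightarrow> nat) \<Rightarrow> nat \<Rightarrow> nat \<Rightarrow> real \<Rightarrow> 'a config \<Rightarrow> 'a config set" where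
  "Tdelta_words \<mu> F gp gm p n \<delta> x =
     (\<lambda>z. restrict z (Jset gp gm p n x)) ` (Tset F gp gm p n x \<inter> Xset \<mu> gp gm p n \<delta>)"

definition Mnpd :: "'a config measure \<Rightarrow> ('a config \<Rightarrow> 'a config) \<Rightarrow> (nat \<Rightarrow> 'a config \<Rightarrow> nat) \<Rightarrow> (nat \<Rightarrow> 'a config \<Rightarrow> nat) \<Rightarrow> nat \<Rightarrow> nat \<Rightarrow> real \<Rightarrow> real" where
  "Mnpd \<mu> F gp gm n p \<delta> = (\<integral>x. (1 - ln (real (card (Tdelta_words \<mu> F gp gm p n \<delta> x)))
        / (- ln (measure \<mu> (Galpha gp gm p n x)))) \<partial>\<mu>)"

definition density_flow :: "'a config measure \<Rightarrow> ('a config \<Rightarrow> 'a config) \<Rightarrow> (nat \<Rightarrow> 'a config \<Rightarrow> nat) \<Rightarrow> (nat \<Rightarrow> 'a config \<Rightarrow> nat) \<Rightarrow> ereal" where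
  "density_flow \<mu> F gp gm = (SUP p. Limsup (at_right (0::real))
      (\<lambda>\<delta>. Limsup sequentially (\<lambda>n. ereal (Mnpd \<mu> F gp gm n p \<delta>))))"

definition density_flow_v :: "'a config measure \<Rightarrow> ('a config \<Rightarrow> 'a config) \<Rightarrow> real \<Rightarrow> real \<Rightarrow> ereal" where
  "density_flow_v \<mu> F vp vm = density_flow \<mu> F
     (\<lambda>n _. nat \<lceil>vp * real n\<rceil>) (\<lambda>n _. nat \<lceil>vm * real n\<rceil>)"

end

theory Submission
  imports Defs "HOL-Real_Asymp.Real_Asymp"
begin

text \<open>
  Write \<open>W\<close> for the word of a random configuration on the window \<open>J\<^sub>n\<close>, of length \<open>L\<close>, and \<open>Y\<close> for the
  \<open>F\<close>-itinerary of the central coordinates up to time \<open>n\<close>. Encoding \<open>W\<close> given \<open>Y\<close> by its rank among the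
  words of \<open>T\<close> that lie in \<open>X\<close>, and by its plain letters on the small exceptional set, gives
  \<open>H(W) \<le> H(Y) + ln 2 + \<integral> ln #T + \<delta> L ln #A + o(L)\<close>. Here \<open>H(W) \<ge> h L\<close> and \<open>H(Y)/n \<rightarrow> h(F, \<alpha>\<^sub>p)\<close>, so the bound on the
  density flow follows once the information of \<open>W\<close> is at most \<open>(h + \<epsilon>) L\<close> with high probability and
  \<open>h\<close> is the entropy of the generator given by the coordinate at \<open>0\<close>.

  Only this upper half of the Shannon--McMillan theorem is needed, and not that \<open>\<eta>\<close> tends to \<open>0\<close>: for
  every \<open>\<eta>\<close> the set \<open>X\<close> has measure at least \<open>1 - \<delta>\<close>.
  That half is obtained by comparing \<open>\<mu>\<close> with its Markov approximations, whose information is a Birkhoff sum.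
\<close>

subsection \<open>Entropy of simple functions\<close>

text \<open>The integrand divides \<open>ln #T\<close> by the information of \<open>W\<close>, which
  varies with the point, so a lower bound for the integral of \<open>ln #T\<close> does not bound
  the quotient. The remedy is one-sided: where the information is at most the cap
  \<open>c = (h + \<epsilon>) * L\<close> the quotient is at least \<open>ln #T / c\<close>, and
  elsewhere it is merely nonnegative. Hence only atypically improbable words have to be removed, and
  ranks are taken inside the set \<open>G\<close> of words that come from \<open>X\<close> and
  respect the cap. In the other direction the average information is controlled without any
  typicality: Fekete's limit is an infimum, so \<open>h * L\<close> is a lower bound at every
  length. The errors vanish in a fixed order: \<open>ln 2 / L\<close> and the probability of
  breaking the cap as \<open>n\<close> grows, then the charge \<open>\<delta> * ln #A\<close> with
  \<delta>, and last the loss \<open>1 - h / (h + \<epsilon>)\<close> with \<epsilon>.\<close>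

definition fibre_prob :: "'b measure \<Rightarrow> ('b \<Rightarrow> 'c) \<Rightarrow> 'c \<Rightarrow> real" where
  "fibre_prob M X v = measure M (X -` {v} \<inter> space M)"

lemma fibre_prob_nonneg [simp]: "0 \<le> fibre_prob M X v"
  by (simp add: fibre_prob_def)

lemma simple_function_fibre_sets:
  "simple_function M X \<Longrightarrow> X -` S \<inter> space M \<in> sets M"
  by (rule simple_functionD(2))

lemma simple_function_measurable_comp:
  assumes "simple_function M X"
  shows "(\<lambda>\<omega>. (g (X \<omega>) :: real)) \<in> borel_measurable M"
  using simple_function_compose1[OF assms, of g] by (rule borel_measurable_simple_function)

context prob_space
begin

lemma fibre_prob_le_1 [simp]: "fibre_prob M X v \<le> 1"
  by (simp add: fibre_prob_def)

lemma integrable_simple_comp: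
  assumes "simple_function M X"
  shows "integrable M (\<lambda>\<omega>. (g (X \<omega>) :: real))"
proof (rule integrable_const_bound)
  have "finite (X ` space M)" using assms by (simp add: simple_function_def)
  then show "AE \<omega> in M. norm (g (X \<omega>)) \<le> (\<Sum>v\<in>X ` space M. norm (g v))"
    by (intro AE_I2 member_le_sum[of "X _" "X ` space M" "\<lambda>v. norm (g v)"]) auto
qed (rule simple_function_measurable_comp[OF assms])

lemma integral_simple_comp:
  assumes "simple_function M X"
  shows "(\<integral>\<omega>. (g (X \<omega>) :: real) \<partial>M) = (\<Sum>v\<in>X ` space M. g v * fibre_prob M X v)"
proof -
  have fin: "finite (X ` space M)" using assms by (simp add: simple_function_def)
  have S: "X -` {v} \<inter> space M \<in> sets M" for v using assms by (rule simple_function_fibre_sets)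
  have "(\<integral>\<omega>. g (X \<omega>) \<partial>M) = (\<integral>\<omega>. (\<Sum>v\<in>X ` space M. g v * indicator (X -` {v} \<inter> space M) \<omega>) \<partial>M)"
  proof (rule Bochner_Integration.integral_cong[OF refl])
    fix \<omega> assume "\<omega> \<in> space M"
    then have "(\<Sum>v\<in>X ` space M. g v * indicator (X -` {v} \<inter> space M) \<omega>)
        = (\<Sum>v\<in>X ` space M. if v = X \<omega> then g v else 0)"
      by (intro sum.cong) (auto simp: indicator_def)
    also have "\<dots> = g (X \<omega>)" using fin \<open>\<omega> \<in> space M\<close> by (simp add: sum.delta')
    finally show "g (X \<omega>) = (\<Sum>v\<in>X ` space M. g v * indicator (X -` {v} \<inter> space M) \<omega>)" by simp
  qed
  also have "\<dots> = (\<Sum>v\<in>X ` space M. g v * fibre_prob M X v)"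
    by (subst Bochner_Integration.integral_sum)
      (use S in \<open>auto simp: fibre_prob_def intro!: integrable_mult_right integrable_real_indicator simp: emeasure_eq_measure\<close>)
  finally show ?thesis .
qed

lemma sum_fibre_prob:
  "simple_function M X \<Longrightarrow> (\<Sum>v\<in>X ` space M. fibre_prob M X v) = 1"
  using integral_simple_comp[of X "\<lambda>_. 1"] by (simp add: prob_space)

lemma part_entropy_eq_integral:
  "simple_function M X \<Longrightarrow> part_entropy M X = (\<integral>\<omega>. - ln (fibre_prob M X (X \<omega>)) \<partial>M)"
  by (subst integral_simple_comp[of X "\<lambda>v. - ln (fibre_prob M X v)"])
    (simp_all add: part_entropy_def fibre_prob_def sum_negf mult.commute)

text \<open>Finitely many values are taken, so those of probability 0 have a null preimage
  altogether. On its complement logarithms of fibre probabilities may be split.\<close>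

lemma AE_fibre_prob_pos:
  assumes "simple_function M X"
  shows "AE \<omega> in M. 0 < fibre_prob M X (X \<omega>)"
proof (rule AE_I')
  have fin: "finite (X ` space M)" using assms by (simp add: simple_function_def)
  let ?V = "{v \<in> X ` space M. fibre_prob M X v = 0}"
  have "emeasure M (X -` {v} \<inter> space M) = 0" if "v \<in> ?V" for v
    using that by (simp add: fibre_prob_def emeasure_eq_measure)
  then show "(\<Union>v\<in>?V. X -` {v} \<inter> space M) \<in> null_sets M"
    using fin assms by (intro null_sets_UN') (auto intro!: countable_finite simple_function_fibre_sets)
  show "{\<omega> \<in> space M. \<not> 0 < fibre_prob M X (X \<omega>)} \<subseteq> (\<Union>v\<in>?V. X -` {v} \<inter> space M)"
    by (auto simp: not_less order.antisym[OF _ fibre_prob_nonneg])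
qed

lemma part_entropy_nonneg: "0 \<le> part_entropy M X"
proof -
  have "x * ln x \<le> 0" if "0 \<le> x" "x \<le> 1" for x :: real
    using that by (cases "x = 0") (auto intro!: mult_nonneg_nonpos)
  then show ?thesis unfolding part_entropy_def neg_0_le_iff_le
    by (intro sum_nonpos) simp
qed

text \<open>Fibres of the finer map lie inside fibres of the coarser one, so the comparison already
  holds pointwise for the information.\<close>

lemma part_entropy_mono:
  assumes X: "simple_function M X" and Y: "simple_function M Y"
    and fac: "\<And>x y. x \<in> space M \<Longrightarrow> y \<in> space M \<Longrightarrow> X x = X y \<Longrightarrow> Y x = Y y"
  shows "part_entropy M Y \<le> part_entropy M X"
  unfolding part_entropy_eq_integral[OF X] part_entropy_eq_integral[OF Y]
proof (rule integral_mono_AE)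
  show "AE \<omega> in M. - ln (fibre_prob M Y (Y \<omega>)) \<le> - ln (fibre_prob M X (X \<omega>))"
    using AE_fibre_prob_pos[OF X] AE_space
  proof eventually_elim
    case (elim \<omega>)
    have "fibre_prob M X (X \<omega>) \<le> fibre_prob M Y (Y \<omega>)" unfolding fibre_prob_def
    proof (rule finite_measure_mono)
      show "X -` {X \<omega>} \<inter> space M \<subseteq> Y -` {Y \<omega>} \<inter> space M"
        using fac[OF _ elim(2)] by blast
    qed (rule simple_function_fibre_sets[OF Y])
    with elim show ?case by simp
  qed
qed (rule integrable_simple_comp[OF Y, of "\<lambda>v. - ln (fibre_prob M Y v)"]
    integrable_simple_comp[OF X, of "\<lambda>v. - ln (fibre_prob M X v)"])+

lemma part_entropy_cong:
  assumes "simple_function M X" "simple_function M Y"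
    and "\<And>x y. x \<in> space M \<Longrightarrow> y \<in> space M \<Longrightarrow> X x = X y \<longleftrightarrow> Y x = Y y"
  shows "part_entropy M Y = part_entropy M X"
  using assms by (intro antisym part_entropy_mono) auto

text \<open>Gibbs' inequality for conditional sub-probabilities \<open>q x y\<close>; every entropy estimate
  below is an instance with a suitable \<open>q\<close>.\<close>

lemma part_entropy_pair_le:
  assumes X: "simple_function M X" and Y: "simple_function M Y"
    and q0: "\<And>x y. 0 \<le> q x y"
    and q1: "\<And>y. y \<in> Y ` space M \<Longrightarrow> (\<Sum>x\<in>X ` space M. q x y) \<le> (1::real)"
    and qpos: "AE \<omega> in M. 0 < q (X \<omega>) (Y \<omega>)"
  shows "part_entropy M (\<lambda>\<omega>. (X \<omega>, Y \<omega>)) \<le> part_entropy M Y + (\<integral>\<omega>. - ln (q (X \<omega>) (Y \<omega>)) \<partial>M)"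
proof -
  let ?Z = "\<lambda>\<omega>. (X \<omega>, Y \<omega>)"
  have Z: "simple_function M ?Z" using X Y by (rule simple_function_Pair)
  let ?PZ = "fibre_prob M ?Z" and ?PY = "fibre_prob M Y"
  have finX: "finite (X ` space M)" and finY: "finite (Y ` space M)"
    using X Y by (auto simp: simple_function_def)
  note int = integrable_simple_comp[OF Z]
  have "part_entropy M ?Z - part_entropy M Y - (\<integral>\<omega>. - ln (q (X \<omega>) (Y \<omega>)) \<partial>M)
     = (\<integral>\<omega>. - ln (?PZ (?Z \<omega>)) + ln (?PY (Y \<omega>)) + ln (q (X \<omega>) (Y \<omega>)) \<partial>M)"
    unfolding part_entropy_eq_integral[OF Z] part_entropy_eq_integral[OF Y]
    using int[of "\<lambda>z. - ln (?PZ z)"] int[of "\<lambda>z. ln (?PY (snd z))"] int[of "\<lambda>z. ln (case_prod q z)"]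
    by simp
  also have "\<dots> \<le> (\<integral>\<omega>. ?PY (Y \<omega>) * q (X \<omega>) (Y \<omega>) / ?PZ (?Z \<omega>) - 1 \<partial>M)"
  proof (rule integral_mono_AE)
    show "AE \<omega> in M. - ln (?PZ (?Z \<omega>)) + ln (?PY (Y \<omega>)) + ln (q (X \<omega>) (Y \<omega>))
        \<le> ?PY (Y \<omega>) * q (X \<omega>) (Y \<omega>) / ?PZ (?Z \<omega>) - 1"
      using AE_fibre_prob_pos[OF Z] AE_fibre_prob_pos[OF Y] qpos
    proof eventually_elim
      case (elim \<omega>)
      \<comment> \<open>The density of the comparison law \<open>P_Y * q\<close> relative to the
        joint law. Its mean is at most 1, so \<open>ln t \<le> t - 1\<close> makes the integral
        nonpositive.\<close>
      let ?t = "?PY (Y \<omega>) * q (X \<omega>) (Y \<omega>) / ?PZ (?Z \<omega>)"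
      have "ln ?t \<le> ?t - 1" using elim by (intro ln_le_minus_one) auto
      then show ?case using elim by (simp add: ln_mult ln_div)
    qed
    show "integrable M (\<lambda>\<omega>. - ln (?PZ (?Z \<omega>)) + ln (?PY (Y \<omega>)) + ln (q (X \<omega>) (Y \<omega>)))"
      using int[of "\<lambda>z. - ln (?PZ z) + ln (?PY (snd z)) + ln (case_prod q z)"] by simp
    show "integrable M (\<lambda>\<omega>. ?PY (Y \<omega>) * q (X \<omega>) (Y \<omega>) / ?PZ (?Z \<omega>) - 1)"
      using int[of "\<lambda>z. ?PY (snd z) * case_prod q z / ?PZ z - 1"] by simp
  qed
  also have "\<dots> = (\<integral>\<omega>. ?PY (Y \<omega>) * q (X \<omega>) (Y \<omega>) / ?PZ (?Z \<omega>) \<partial>M) - 1"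
    using int[of "\<lambda>z. ?PY (snd z) * case_prod q z / ?PZ z"] by (simp add: prob_space)
  also have "(\<integral>\<omega>. ?PY (Y \<omega>) * q (X \<omega>) (Y \<omega>) / ?PZ (?Z \<omega>) \<partial>M)
      = (\<Sum>z\<in>?Z ` space M. ?PY (snd z) * case_prod q z / ?PZ z * ?PZ z)"
    using integral_simple_comp[OF Z, of "\<lambda>z. ?PY (snd z) * case_prod q z / ?PZ z"] by simp
  \<comment> \<open>Only an inequality: at a value of joint probability 0 the left term is
    0.\<close>
  also have "\<dots> \<le> (\<Sum>z\<in>?Z ` space M. ?PY (snd z) * case_prod q z)"
    by (intro sum_mono) (auto simp: q0)
  also have "\<dots> \<le> (\<Sum>z\<in>X ` space M \<times> Y ` space M. ?PY (snd z) * case_prod q z)"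
    using finX finY by (intro sum_mono2) (auto simp: q0)
  also have "\<dots> = (\<Sum>y\<in>Y ` space M. ?PY y * (\<Sum>x\<in>X ` space M. q x y))"
    by (subst sum.cartesian_product', subst sum.swap) (simp add: sum_distrib_left)
  also have "\<dots> \<le> (\<Sum>y\<in>Y ` space M. ?PY y * 1)"
    by (intro sum_mono mult_left_mono q1) auto
  also have "\<dots> = 1" using sum_fibre_prob[OF Y] by simp
  finally show ?thesis by simp
qed

text \<open>The comparison law is the independent one: \<open>q\<close> ignores its second
  argument.\<close>

lemma part_entropy_pair_subadd:
  assumes X: "simple_function M X" and Y: "simple_function M Y"
  shows "part_entropy M (\<lambda>\<omega>. (X \<omega>, Y \<omega>)) \<le> part_entropy M X + part_entropy M Y"
  using part_entropy_pair_le[OF X Y, of "\<lambda>x y. fibre_prob M X x"] sum_fibre_prob[OF X]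
    AE_fibre_prob_pos[OF X] part_entropy_eq_integral[OF X] by simp

end

subsection \<open>Measure-preserving maps\<close>

locale mp_system = prob_space M for M :: "'b measure" +
  fixes T :: "'b \<Rightarrow> 'b"
  assumes mp: "measure_preserving M T"
begin

lemma T_measurable: "T \<in> measurable M M"
  using mp by (simp add: measure_preserving_def)

lemma T_space: "x \<in> space M \<Longrightarrow> T x \<in> space M"
  using T_measurable by (rule measurable_space)

lemma funpow_measurable: "(T ^^ n) \<in> measurable M M"
proof (induction n)
  case (Suc n)
  show ?case unfolding funpow.simps by (rule measurable_comp[OF Suc T_measurable])
qed (simp add: id_def)

lemma funpow_space: "x \<in> space M \<Longrightarrow> (T ^^ n) x \<in> space M"
  using funpow_measurable by (rule measurable_space)

lemma distr_funpow: "distr M M (T ^^ n) = M"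
proof (induction n)
  case (Suc n)
  have "distr M M (T ^^ Suc n) = distr (distr M M (T ^^ n)) M T"
    unfolding funpow.simps by (rule distr_distr[symmetric, OF T_measurable funpow_measurable])
  also have "\<dots> = M" using mp unfolding Suc by (simp add: measure_preserving_def)
  finally show ?case .
qed (simp add: id_def)

lemma integral_funpow:
  "g \<in> borel_measurable M \<Longrightarrow> (\<integral>x. (g ((T ^^ n) x) :: real) \<partial>M) = (\<integral>x. g x \<partial>M)"
  using integral_distr[OF funpow_measurable[of n], of g] by (simp add: distr_funpow)

lemma measure_funpow_vimage:
  "A \<in> sets M \<Longrightarrow> measure M ((T ^^ n) -` A \<inter> space M) = measure M A"
  using measure_distr[OF funpow_measurable[of n], of A] by (simp add: distr_funpow)

lemma simple_function_funpow:
  assumes "simple_function M X" shows "simple_function M (\<lambda>x. X ((T ^^ n) x))"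
  unfolding simple_function_def
proof
  have "(\<lambda>x. X ((T ^^ n) x)) ` space M \<subseteq> X ` space M" using funpow_space by auto
  then show "finite ((\<lambda>x. X ((T ^^ n) x)) ` space M)"
    using assms by (auto simp: simple_function_def intro: finite_subset)
  have "(\<lambda>x. X ((T ^^ n) x)) -` {v} \<inter> space M = (T ^^ n) -` (X -` {v} \<inter> space M) \<inter> space M" for v
    using funpow_space by auto
  then show "\<forall>v\<in>(\<lambda>x. X ((T ^^ n) x)) ` space M. (\<lambda>x. X ((T ^^ n) x)) -` {v} \<inter> space M \<in> sets M"
    using measurable_sets[OF funpow_measurable simple_function_fibre_sets[OF assms]] by simp
qed

lemma fibre_prob_funpow:
  assumes "simple_function M X"
  shows "fibre_prob M (\<lambda>x. X ((T ^^ n) x)) v = fibre_prob M X v"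
proof -
  have "(\<lambda>x. X ((T ^^ n) x)) -` {v} \<inter> space M = (T ^^ n) -` (X -` {v} \<inter> space M) \<inter> space M"
    using funpow_space by auto
  then show ?thesis
    using measure_funpow_vimage[OF simple_function_fibre_sets[OF assms]] by (simp add: fibre_prob_def)
qed

lemma part_entropy_funpow:
  assumes X: "simple_function M X"
  shows "part_entropy M (\<lambda>x. X ((T ^^ n) x)) = part_entropy M X"
  using integral_funpow[of "\<lambda>x. - ln (fibre_prob M X (X x))" n]
    simple_function_measurable_comp[OF X, of "\<lambda>v. - ln (fibre_prob M X v)"]
  by (simp add: part_entropy_eq_integral[OF X] part_entropy_eq_integral[OF simple_function_funpow[OF X]]
      fibre_prob_funpow[OF X])

end

subsection \<open>Entropy of a partition\<close>

text \<open>The limit is built as an infimum, which is why the second conclusion is available. It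
  later bounds block entropies from below at every finite length, without error term.\<close>

lemma fekete_subadditive:
  fixes a :: "nat \<Rightarrow> real"
  assumes nonneg: "\<And>n. 0 \<le> a n" and sub: "\<And>m n. a (m + n) \<le> a m + a n"
  obtains l where "(\<lambda>n. a n / real n) \<longlonglongrightarrow> l" "\<And>n. 0 < n \<Longrightarrow> l \<le> a n / real n"
proof -
  define l where "l = (INF n\<in>{0<..}. a n / real n)"
  have bdd: "bdd_below ((\<lambda>n. a n / real n) ` {0<..})"
    using nonneg by (intro bdd_belowI[of _ 0]) auto
  have lower: "l \<le> a n / real n" if "0 < n" for n
    unfolding l_def using that by (intro cINF_lower[OF bdd]) simp
  have mult: "a (q * m + s) \<le> real q * a m + a s" for q m s
  proof (induction q)
    case (Suc q)
    have "a (Suc q * m + s) \<le> a m + a (q * m + s)" using sub[of m "q * m + s"] by (simp add: add.assoc)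
    with Suc show ?case by (simp add: algebra_simps)
  qed simp
  have "(\<lambda>n. a n / real n) \<longlonglongrightarrow> l"
  proof (rule LIMSEQ_I)
    fix e :: real assume "0 < e"
    then have "\<exists>m\<in>{0<..}. a m / real m < l + e / 2"
      unfolding l_def using bdd by (subst cINF_less_iff[symmetric]) auto
    then obtain m where m: "0 < m" "a m / real m < l + e / 2" by auto
    \<comment> \<open>A bound for all remainders of division by \<open>m\<close>; the sum can stand
      in for the maximum because the terms are nonnegative.\<close>
    define C where "C = (\<Sum>s<m. a s)"
    have C: "a s \<le> C" if "s < m" for s
      unfolding C_def using that nonneg by (intro member_le_sum) auto
    obtain N where N: "2 * C / e < real N" using reals_Archimedean2 by blast
    show "\<exists>N. \<forall>n\<ge>N. norm (a n / real n - l) < e"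
    proof (intro exI allI impI)
      fix n assume n: "max 1 N \<le> n"
      have "a n \<le> real (n div m) * a m + C"
        using mult[of "n div m" m "n mod m"] C[of "n mod m"] m by simp
      also have "real (n div m) * a m \<le> (real n / real m) * a m"
        using nonneg[of m] by (intro mult_right_mono) (auto intro: of_nat_div_le_of_nat)
      finally have "a n / real n \<le> (real n / real m * a m + C) / real n"
        using n by (intro divide_right_mono) auto
      also have "\<dots> = a m / real m + C / real n" using n m by (simp add: field_simps)
      also have "\<dots> < (l + e / 2) + e / 2"
      proof (rule add_strict_mono[OF m(2)])
        have "2 * C / e < real n" using N n by linarith
        then show "C / real n < e / 2" using \<open>0 < e\<close> n by (simp add: field_simps)
      qed
      finally show "norm (a n / real n - l) < e" using lower[of n] n by auto
    qed
  qed
  with lower show ?thesis by (rule that[rotated])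
qed

lemma fin_partition_simple: "fin_partition M \<xi> \<Longrightarrow> simple_function M \<xi>"
  unfolding fin_partition_def simple_function_def by (auto intro: measurable_sets)

lemma simple_fin_partition:
  "simple_function M \<xi> \<Longrightarrow> fin_partition M \<xi>"
  unfolding fin_partition_def by (simp add: measurable_simple_function simple_functionD(1))

lemma itinerary_add:
  "itinerary T \<xi> (m + n) x = itinerary T \<xi> m x @ itinerary T \<xi> n ((T ^^ m) x)"
proof -
  have "[m..<m + n] = map (\<lambda>i. i + m) [0..<n]" by (simp add: map_add_upt add.commute)
  then show ?thesis unfolding itinerary_def upt_add_eq_append[of 0 m n, simplified]
    by (simp add: funpow_add o_def)
qed

lemma length_itinerary [simp]: "length (itinerary T \<xi> n x) = n"
  by (simp add: itinerary_def)

context mp_system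
begin

lemma itinerary_simple:
  assumes "fin_partition M \<xi>" shows "simple_function M (itinerary T \<xi> n)"
proof (induction n)
  case 0
  then show ?case by (simp add: itinerary_def[abs_def])
next
  case (Suc n)
  have "itinerary T \<xi> (Suc n) = (\<lambda>x. (\<lambda>(u, v). u @ [v]) (itinerary T \<xi> n x, \<xi> ((T ^^ n) x)))"
    by (auto simp: itinerary_def)
  then show ?case
    using simple_function_compose1[OF simple_function_Pair[OF Suc
        simple_function_funpow[OF fin_partition_simple[OF assms], of n]], of "\<lambda>(u, v). u @ [v]"] by simp
qed

lemma part_entropy_itinerary_subadd:
  assumes \<xi>: "fin_partition M \<xi>"
  shows "part_entropy M (itinerary T \<xi> (m + n))
    \<le> part_entropy M (itinerary T \<xi> m) + part_entropy M (itinerary T \<xi> n)"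
proof -
  note S = itinerary_simple[OF \<xi>]
  let ?Y = "\<lambda>x. itinerary T \<xi> n ((T ^^ m) x)"
  have Y: "simple_function M ?Y" by (rule simple_function_funpow[OF S])
  have "part_entropy M (itinerary T \<xi> (m + n)) = part_entropy M (\<lambda>x. (itinerary T \<xi> m x, ?Y x))"
    by (rule part_entropy_cong[OF simple_function_Pair[OF S Y] S]) (simp add: itinerary_add)
  also have "\<dots> \<le> part_entropy M (itinerary T \<xi> m) + part_entropy M ?Y"
    by (rule part_entropy_pair_subadd[OF S Y])
  finally show ?thesis by (simp add: part_entropy_funpow[OF S])
qed

text \<open>\<open>lim\<close> is meaningful only once convergence is known, which subadditivity
  supplies. The quotients in \<open>entropy_rel\<close> start at length 1, hence the index
  shift.\<close>

lemma entropy_rel_limit: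
  assumes \<xi>: "fin_partition M \<xi>"
  shows "(\<lambda>n. part_entropy M (itinerary T \<xi> n) / real n) \<longlonglongrightarrow> entropy_rel M T \<xi>"
    and "0 < n \<Longrightarrow> entropy_rel M T \<xi> \<le> part_entropy M (itinerary T \<xi> n) / real n"
proof -
  obtain l where l: "(\<lambda>n. part_entropy M (itinerary T \<xi> n) / real n) \<longlonglongrightarrow> l"
      "\<And>n. 0 < n \<Longrightarrow> l \<le> part_entropy M (itinerary T \<xi> n) / real n"
    using fekete_subadditive[of "\<lambda>n. part_entropy M (itinerary T \<xi> n)"]
      part_entropy_nonneg part_entropy_itinerary_subadd[OF \<xi>] by blast
  have "entropy_rel M T \<xi> = l"
    unfolding entropy_rel_def using LIMSEQ_Suc[OF l(1)] by (intro limI) simp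
  with l show "(\<lambda>n. part_entropy M (itinerary T \<xi> n) / real n) \<longlonglongrightarrow> entropy_rel M T \<xi>"
    and "0 < n \<Longrightarrow> entropy_rel M T \<xi> \<le> part_entropy M (itinerary T \<xi> n) / real n" by auto
qed

lemma entropy_rel_nonneg: "fin_partition M \<xi> \<Longrightarrow> 0 \<le> entropy_rel M T \<xi>"
  by (rule LIMSEQ_le_const[OF entropy_rel_limit(1)]) (auto intro!: exI[of _ 0] divide_nonneg_nonneg part_entropy_nonneg)

end

subsection \<open>Birkhoff sums of functions with negative mean\<close>

definition birkhoff_sum :: "('b \<Rightarrow> 'b) \<Rightarrow> ('b \<Rightarrow> real) \<Rightarrow> nat \<Rightarrow> 'b \<Rightarrow> real" where
  "birkhoff_sum T g n x = (\<Sum>i<n. g ((T ^^ i) x))"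

text \<open>The maximum of the Birkhoff sums of lengths 0 to \<open>n\<close>. The recursion peels
  off the first point of the orbit, the form that the maximal inequality uses.\<close>

primrec max_birkhoff_sum :: "('b \<Rightarrow> 'b) \<Rightarrow> ('b \<Rightarrow> real) \<Rightarrow> nat \<Rightarrow> 'b \<Rightarrow> real" where
  "max_birkhoff_sum T g 0 x = 0"
| "max_birkhoff_sum T g (Suc n) x = max 0 (g x + max_birkhoff_sum T g n (T x))"

lemma birkhoff_sum_Suc: "birkhoff_sum T g (Suc n) x = g x + birkhoff_sum T g n (T x)"
  by (simp add: birkhoff_sum_def sum.lessThan_Suc_shift funpow_swap1 del: sum.lessThan_Suc)

lemma birkhoff_sum_le_max: "birkhoff_sum T g n x \<le> max_birkhoff_sum T g n x"
proof (induction n arbitrary: x)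
  case (Suc n)
  show ?case using Suc[of "T x"] by (simp add: birkhoff_sum_Suc)
qed (simp add: birkhoff_sum_def)

lemma max_birkhoff_sum_nonneg: "0 \<le> max_birkhoff_sum T g n x"
  by (cases n) auto

lemma max_birkhoff_sum_mono: "max_birkhoff_sum T g n x \<le> max_birkhoff_sum T g (Suc n) x"
proof (induction n arbitrary: x)
  case (Suc n)
  show ?case using Suc[of "T x"] by simp
qed simp

locale bounded_observable = mp_system M T for M :: "'b measure" and T +
  fixes g :: "'b \<Rightarrow> real" and B :: real
  assumes g_meas [measurable]: "g \<in> borel_measurable M"
    and g_bound: "\<And>x. x \<in> space M \<Longrightarrow> \<bar>g x\<bar> \<le> B"
begin

abbreviation "F \<equiv> max_birkhoff_sum T g"

lemma F_meas [measurable]: "F n \<in> borel_measurable M"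
proof (induction n)
  case (Suc n)
  have "(\<lambda>x. F n (T x)) \<in> borel_measurable M" using T_measurable Suc by (rule measurable_compose)
  moreover have "F (Suc n) = (\<lambda>x. max 0 (g x + F n (T x)))" by auto
  ultimately show ?case by simp
next
  case 0
  have "F 0 = (\<lambda>x. 0)" by auto
  then show ?case by simp
qed

lemma F_bound: "x \<in> space M \<Longrightarrow> \<bar>F n x\<bar> \<le> real n * B"
proof (induction n arbitrary: x)
  case (Suc n)
  have "0 \<le> real n * B" using g_bound[OF Suc.prems] by simp
  then show ?case using Suc.IH[OF T_space[OF Suc.prems]] g_bound[OF Suc.prems]
    by (auto simp: algebra_simps max_def)
qed simp

lemma F_integrable: "integrable M (F n)"
  by (rule integrable_const_bound[of _ "real n * B"]) (auto intro!: F_bound)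

text \<open>Garsia's argument: where \<open>F n x > 0\<close> the recursion and monotonicity give
  \<open>F n x \<le> g x + F n (T x)\<close>, elsewhere \<open>F n x = 0 \<le> F n (T x)\<close>;
  and \<open>F n x - F n (T x)\<close> has integral 0 by invariance.\<close>

lemma maximal_ergodic: "0 \<le> (\<integral>x. g x * indicator {x \<in> space M. 0 < F n x} x \<partial>M)"
proof (cases n)
  case (Suc m)
  have FT: "integrable M (\<lambda>x. F n (T x))"
    by (rule integrable_const_bound[of _ "real n * B"])
      (auto intro!: F_bound T_space measurable_compose[OF T_measurable F_meas])
  have "0 = (\<integral>x. F n x - F n (T x) \<partial>M)"
    using F_integrable FT integral_funpow[OF F_meas[of n], of 1] by simp
  also have "\<dots> \<le> (\<integral>x. g x * indicator {x \<in> space M. 0 < F n x} x \<partial>M)"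
  proof (rule integral_mono)
    show "integrable M (\<lambda>x. F n x - F n (T x))" using F_integrable FT by simp
    show "integrable M (\<lambda>x. g x * indicator {x \<in> space M. 0 < F n x} x)"
    proof (rule integrable_const_bound[of _ B])
      show "AE x in M. norm (g x * indicator {x \<in> space M. 0 < F n x} x) \<le> B"
      proof (rule AE_I2)
        fix x assume "x \<in> space M"
        from g_bound[OF this] show "norm (g x * indicator {x \<in> space M. 0 < F n x} x) \<le> B"
          by (auto simp: indicator_def)
      qed
    qed simp
    fix x assume x: "x \<in> space M"
    show "F n x - F n (T x) \<le> g x * indicator {x \<in> space M. 0 < F n x} x"
    proof (cases "0 < F n x")
      case True
      then have "F n x = g x + F m (T x)" unfolding Suc by (auto simp: max_def split: if_splits)
      with True x max_birkhoff_sum_mono[of T g m "T x"] show ?thesis by (simp add: Suc del: max_birkhoff_sum.simps)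
    next
      case False
      with max_birkhoff_sum_nonneg[of T g n "T x"] show ?thesis by simp
    qed
  qed
  finally show ?thesis .
qed simp

text \<open>The set where the maximal sums are unbounded is invariant. If it had measure 1, the sets
  in the maximal inequality would increase to almost everything and the mean of \<open>g\<close>
  would be nonnegative. So it is null: almost every orbit has Birkhoff sums bounded above, and a
  linear threshold is eventually out of reach.\<close>

lemma birkhoff_sum_small:
  assumes erg: "ergodic M T" and neg: "(\<integral>x. g x \<partial>M) < 0" and e: "0 < e"
  shows "(\<lambda>n. measure M {x \<in> space M. e * real n < birkhoff_sum T g n x}) \<longlonglongrightarrow> 0"
proof -
  define E where "E = {x \<in> space M. \<forall>K::nat. \<exists>N. real K < F N x}"
  have E: "E \<in> sets M" unfolding E_def by measurable
  have inv: "T -` E \<inter> space M = E"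
  proof (intro set_eqI iffI)
    fix x assume "x \<in> T -` E \<inter> space M"
    then have x: "x \<in> space M" and TE: "T x \<in> E" by auto
    have "\<exists>N. real K < F N x" for K
    proof -
      \<comment> \<open>The surplus \<open>nat \<lceil>B\<rceil>\<close> absorbs the single value
        \<open>g x\<close> by which the two maximal sums can differ.\<close>
      obtain N where "real (K + nat \<lceil>B\<rceil>) < F N (T x)" using TE unfolding E_def by blast
      then have "real K < g x + F N (T x)"
        using g_bound[OF x] real_nat_ceiling_ge[of B] unfolding of_nat_add by linarith
      then have "real K < F (Suc N) x" by (simp add: less_max_iff_disj)
      then show ?thesis by blast
    qed
    with x show "x \<in> E" by (simp add: E_def)
  next
    fix x assume "x \<in> E"
    then have x: "x \<in> space M" by (simp add: E_def)
    have "\<exists>N. real K < F N (T x)" for K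
    proof -
      obtain N where N: "real (K + nat \<lceil>B\<rceil>) < F N x" using \<open>x \<in> E\<close> unfolding E_def by blast
      then obtain m where m: "N = Suc m" by (cases N) auto
      have "real K + B < max 0 (g x + F m (T x))"
        using N real_nat_ceiling_ge[of B] unfolding m of_nat_add max_birkhoff_sum.simps by linarith
      then have "real K < F m (T x)"
        using g_bound[OF x] max_birkhoff_sum_nonneg[of T g m "T x"] by (auto simp: max_def split: if_splits)
      then show ?thesis by blast
    qed
    with x show "x \<in> T -` E \<inter> space M" by (simp add: E_def T_space)
  qed
  have "measure M E \<noteq> 1"
  proof
    assume "measure M E = 1"
    then have AE_E: "AE x in M. x \<in> E" using E by (simp add: prob_eq_1)
    have "(\<lambda>n. \<integral>x. g x * indicator {x \<in> space M. 0 < F n x} x \<partial>M) \<longlonglongrightarrow> (\<integral>x. g x \<partial>M)"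
    proof (rule integral_dominated_convergence[where w = "\<lambda>_. B"])
      show "AE x in M. (\<lambda>n. g x * indicator {x \<in> space M. 0 < F n x} x) \<longlonglongrightarrow> g x"
        using AE_E
      proof eventually_elim
        case (elim x)
        then have x: "x \<in> space M" and "\<exists>N. real 0 < F N x" unfolding E_def by blast+
        then obtain N where N: "0 < F N x" by auto
        have "0 < F n x" if "N \<le> n" for n
          using lift_Suc_mono_le[of "\<lambda>n. F n x" N n] max_birkhoff_sum_mono that N
          by (meson less_le_trans)
        then have "eventually (\<lambda>n. g x * indicator {x \<in> space M. 0 < F n x} x = g x) sequentially"
          using x by (auto simp: eventually_sequentially intro!: exI[of _ N])
        then show ?case by (rule tendsto_eventually)
      qed
      fix n
      show "AE x in M. norm (g x * indicator {x \<in> space M. 0 < F n x} x) \<le> B"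
      proof (rule AE_I2)
        fix x assume "x \<in> space M"
        from g_bound[OF this] show "norm (g x * indicator {x \<in> space M. 0 < F n x} x) \<le> B"
          by (auto simp: indicator_def)
      qed
    qed auto
    then have "0 \<le> (\<integral>x. g x \<partial>M)"
      by (rule LIMSEQ_le_const) (use maximal_ergodic in auto)
    with neg show False by simp
  qed
  with erg E inv have "measure M E = 0" by (auto simp: ergodic_def)
  then have AE_nE: "AE x in M. x \<notin> E" using E by (simp add: prob_eq_0)
  have [measurable]: "(\<lambda>x. birkhoff_sum T g n x) \<in> borel_measurable M" for n
    unfolding birkhoff_sum_def
    by (intro borel_measurable_sum measurable_compose[OF funpow_measurable g_meas])
  let ?D = "\<lambda>n. {x \<in> space M. e * real n < birkhoff_sum T g n x}"
  have "(\<lambda>n. \<integral>x. indicator (?D n) x \<partial>M) \<longlonglongrightarrow> (\<integral>x. (0::real) \<partial>M)"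
  proof (rule integral_dominated_convergence[where w = "\<lambda>_. 1"])
    show "AE x in M. (\<lambda>n. indicator (?D n) x) \<longlonglongrightarrow> (0::real)"
      using AE_nE AE_space
    proof eventually_elim
      case (elim x)
      then obtain K :: nat where K: "\<And>N. F N x \<le> real K" unfolding E_def by (auto simp: not_less)
      obtain N where N: "real K / e < real N" using reals_Archimedean2 by blast
      have "indicator (?D n) x = (0::real)" if "N \<le> n" for n
      proof -
        have "birkhoff_sum T g n x \<le> real K" using K[of n] birkhoff_sum_le_max[of T g n x] by linarith
        also have "real K < e * real N" using N e by (simp add: field_simps)
        also have "\<dots> \<le> e * real n" using that e by simp
        finally show ?thesis by (simp add: indicator_def)
      qed
      then show ?case
        by (intro tendsto_eventually) (auto simp: eventually_sequentially intro!: exI[of _ N])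
    qed
  qed (auto simp: indicator_def)
  then show ?thesis by simp
qed

end

subsection \<open>The generator theorem for the shift\<close>

text \<open>Also used for cylinder sets, by taking the membership predicate as the map.\<close>

definition depends_on :: "int set \<Rightarrow> ('a config \<Rightarrow> 'c) \<Rightarrow> bool" where
  "depends_on J X \<longleftrightarrow> (\<forall>x y. (\<forall>j\<in>J. x j = y j) \<longrightarrow> X x = X y)"

lemma depends_onD: "depends_on J X \<Longrightarrow> (\<And>j. j \<in> J \<Longrightarrow> x j = y j) \<Longrightarrow> X x = X y"
  by (auto simp: depends_on_def)

lemma depends_on_mono: "depends_on J X \<Longrightarrow> J \<subseteq> K \<Longrightarrow> depends_on K X"
  unfolding depends_on_def by blast

text \<open>Lists forget the position of the window, so the laws of words at different positions can
  be compared; restricted functions would keep the position.\<close>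

definition word :: "int \<Rightarrow> nat \<Rightarrow> 'a config \<Rightarrow> 'a list" where
  "word a n x = map (\<lambda>i. x (a + int i)) [0..<n]"

lemma length_word [simp]: "length (word a n x) = n"
  by (simp add: word_def)

lemma word_eq_iff: "word a n x = word a n y \<longleftrightarrow> (\<forall>j\<in>{a..<a + int n}. x j = y j)"
proof
  assume eq: "word a n x = word a n y"
  show "\<forall>j\<in>{a..<a + int n}. x j = y j"
  proof
    fix j assume "j \<in> {a..<a + int n}"
    then have "nat (j - a) < n" "a + int (nat (j - a)) = j" by auto
    with arg_cong[OF eq, of "\<lambda>w. w ! nat (j - a)"] show "x j = y j" by (simp add: word_def)
  qed
qed (auto simp: word_def)

lemma word_0 [simp]: "word a 0 x = []"
  by (simp add: word_def)

lemma word_Suc: "word a (Suc n) x = x a # word (a + 1) n x"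
  by (simp add: word_def upt_rec[of 0 "Suc n"] map_Suc_upt[symmetric] o_def algebra_simps del: upt_Suc)

lemma take_word: "k \<le> n \<Longrightarrow> take k (word a n x) = word a k x"
  by (simp add: word_def take_map)

lemma funpow_shift: "(shift ^^ n) x = (\<lambda>j. x (j + int n))"
  by (induction n) (auto simp: shift_def algebra_simps)

lemma word_funpow_shift: "word a n ((shift ^^ i) x) = word (a + int i) n x"
  by (simp add: word_def funpow_shift algebra_simps)

section \<open>Comparing the itineraries of two close partitions\<close>

text \<open>A product of sub-probabilities is one again. The factors may depend on the position
  because they will be conditioned on the letters of a second word.\<close>

lemma sum_lists_prod_le_1:
  fixes c :: "nat \<Rightarrow> 'c \<Rightarrow> real"
  assumes "finite R" and "\<And>i a. 0 \<le> c i a" and "\<And>i. i < n \<Longrightarrow> (\<Sum>a\<in>R. c i a) \<le> 1"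
  shows "(\<Sum>u\<in>{u. set u \<subseteq> R \<and> length u = n}. \<Prod>i<n. c i (u ! i)) \<le> 1"
  using assms(2,3)
proof (induction n arbitrary: c)
  case 0
  have "{u. set u \<subseteq> R \<and> length u = 0} = {[]}" by auto
  then show ?case by simp
next
  case (Suc n)
  let ?L = "{u. set u \<subseteq> R \<and> length u = n}"
  have eq: "{u. set u \<subseteq> R \<and> length u = Suc n} = (\<lambda>(a, u). a # u) ` (R \<times> ?L)"
    by (auto simp: length_Suc_conv image_iff)
  have inj: "inj_on (\<lambda>(a, u). a # u) (R \<times> ?L)" by (auto simp: inj_on_def)
  have "(\<Sum>u\<in>{u. set u \<subseteq> R \<and> length u = Suc n}. \<Prod>i<Suc n. c i (u ! i))
      = (\<Sum>(a, u)\<in>R \<times> ?L. c 0 a * (\<Prod>i<n. c (Suc i) (u ! i)))"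
    unfolding eq sum.reindex[OF inj]
    by (rule sum.cong) (auto simp: prod.lessThan_Suc_shift simp del: prod.lessThan_Suc)
  also have "\<dots> = (\<Sum>a\<in>R. c 0 a) * (\<Sum>u\<in>?L. \<Prod>i<n. c (Suc i) (u ! i))"
    by (simp add: sum_product sum.cartesian_product)
  also have "\<dots> \<le> 1 * 1"
    using Suc.prems by (intro mult_mono Suc.IH) (auto intro!: sum_nonneg prod_nonneg)
  finally show ?case by simp
qed

text \<open>Guess the \<xi>-letters from the \<zeta>-letters: weight \<open>1 - \<delta>\<close> on
  agreement, and \<open>\<delta> / k\<close> on each other letter so that a mismatch costs
  \<open>ln (k / \<delta>)\<close> and not infinity. The guesses multiply along the itinerary, and
  invariance makes every time step cost the same on average.\<close>

lemma (in mp_system) part_entropy_itinerary_perturb: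
  assumes \<xi>: "fin_partition M \<xi>" and \<zeta>: "fin_partition M \<zeta>"
    and R: "finite R" "\<xi> ` space M \<subseteq> R" "\<zeta> ` space M \<subseteq> R"
    and \<delta>: "0 < \<delta>" "\<delta> < 1"
  shows "part_entropy M (itinerary T \<xi> n) \<le> part_entropy M (itinerary T \<zeta> n)
    + real n * (- ln (1 - \<delta>) + measure M {x \<in> space M. \<xi> x \<noteq> \<zeta> x} * ln (real (card R) / \<delta>))"
proof -
  let ?k = "real (card R)"
  have "R \<noteq> {}" using R(2) not_empty by auto
  then have k: "1 \<le> ?k" using R(1) by (simp add: Suc_leI card_gt_0_iff)
  define c :: "nat \<Rightarrow> nat \<Rightarrow> real" where "c b a = (if a = b then 1 - \<delta> else \<delta> / ?k)" for a b
  have c_pos: "0 < c b a" for a b using \<delta> k by (simp add: c_def)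
  have c_sum: "(\<Sum>a\<in>R. c b a) \<le> 1" if "b \<in> R" for b
  proof -
    have "(\<Sum>a\<in>R. c b a) = (1 - \<delta>) + (\<Sum>a\<in>R - {b}. \<delta> / ?k)"
      using R(1) that by (simp add: sum.remove c_def)
    also have "\<dots> \<le> (1 - \<delta>) + (\<Sum>a\<in>R. \<delta> / ?k)"
      using R(1) \<delta> k by (intro add_left_mono sum_mono2) auto
    also have "\<dots> = 1" using k by simp
    finally show ?thesis .
  qed
  define q where "q u b = (\<Prod>i<n. c (b ! i) (u ! i))" for u b
  note X = itinerary_simple[OF \<xi>, of n] and Y = itinerary_simple[OF \<zeta>, of n]
  have sub: "itinerary T \<xi> n ` space M \<subseteq> {u. set u \<subseteq> R \<and> length u = n}"
    using R(2) funpow_space by (auto simp: itinerary_def image_subset_iff)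
  have "part_entropy M (itinerary T \<xi> n) \<le> part_entropy M (\<lambda>x. (itinerary T \<xi> n x, itinerary T \<zeta> n x))"
    by (rule part_entropy_mono[OF simple_function_Pair[OF X Y] X]) simp
  also have "\<dots> \<le> part_entropy M (itinerary T \<zeta> n)
      + (\<integral>x. - ln (q (itinerary T \<xi> n x) (itinerary T \<zeta> n x)) \<partial>M)"
  proof (rule part_entropy_pair_le[OF X Y])
    show "0 \<le> q u b" for u b using c_pos by (simp add: q_def prod_nonneg less_imp_le)
    show "AE x in M. 0 < q (itinerary T \<xi> n x) (itinerary T \<zeta> n x)"
      using c_pos by (simp add: q_def prod_pos)
    fix b assume "b \<in> itinerary T \<zeta> n ` space M"
    then have b: "b ! i \<in> R" if "i < n" for i
      using R(3) funpow_space that by (auto simp: itinerary_def)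
    have "(\<Sum>u\<in>itinerary T \<xi> n ` space M. q u b) \<le> (\<Sum>u\<in>{u. set u \<subseteq> R \<and> length u = n}. q u b)"
      using c_pos by (intro sum_mono2 sub finite_lists_length_eq R(1))
        (simp add: q_def prod_nonneg less_imp_le)
    also have "\<dots> \<le> 1" unfolding q_def using c_pos c_sum b
      by (intro sum_lists_prod_le_1 R(1)) (auto intro: less_imp_le)
    finally show "(\<Sum>u\<in>itinerary T \<xi> n ` space M. q u b) \<le> 1" .
  qed
  also have "(\<integral>x. - ln (q (itinerary T \<xi> n x) (itinerary T \<zeta> n x)) \<partial>M)
      \<le> real n * (- ln (1 - \<delta>) + measure M {x \<in> space M. \<xi> x \<noteq> \<zeta> x} * ln (?k / \<delta>))"
  proof -
    let ?Z = "\<lambda>x. (\<zeta> x, \<xi> x)" and ?D = "{x \<in> space M. \<xi> x \<noteq> \<zeta> x}"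
    let ?f = "\<lambda>z. - ln (case_prod c z)"
    have Z: "simple_function M ?Z"
      by (intro simple_function_Pair fin_partition_simple \<xi> \<zeta>)
    have D: "?D \<in> sets M"
      using simple_function_fibre_sets[OF Z, of "{z. snd z \<noteq> fst z}"] by (simp add: vimage_def Int_def conj_commute)
    have ZT: "simple_function M (\<lambda>x. ?Z ((T ^^ i) x))" for i by (rule simple_function_funpow[OF Z])
    have "(\<integral>x. - ln (q (itinerary T \<xi> n x) (itinerary T \<zeta> n x)) \<partial>M)
        = (\<integral>x. (\<Sum>i<n. ?f (?Z ((T ^^ i) x))) \<partial>M)"
    proof (rule Bochner_Integration.integral_cong[OF refl])
      fix x
      have "c b a \<noteq> 0" for b a using c_pos[of b a] by simp
      then show "- ln (q (itinerary T \<xi> n x) (itinerary T \<zeta> n x)) = (\<Sum>i<n. ?f (?Z ((T ^^ i) x)))"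
        by (simp add: q_def itinerary_def ln_prod c_pos sum_negf)
    qed
    also have "\<dots> = (\<Sum>i<n. \<integral>x. ?f (?Z ((T ^^ i) x)) \<partial>M)"
      by (rule Bochner_Integration.integral_sum) (rule integrable_simple_comp[OF ZT])
    also have "\<dots> = real n * (\<integral>x. ?f (?Z x) \<partial>M)"
      using integral_funpow[OF simple_function_measurable_comp[OF Z, of ?f]] by simp
    also have "(\<integral>x. ?f (?Z x) \<partial>M) \<le> (\<integral>x. - ln (1 - \<delta>) + indicator ?D x * ln (?k / \<delta>) \<partial>M)"
    proof (rule integral_mono)
      show "integrable M (\<lambda>x. ?f (?Z x))" by (rule integrable_simple_comp[OF Z])
      show "integrable M (\<lambda>x. - ln (1 - \<delta>) + indicator ?D x * ln (?k / \<delta>))"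
        using D by (auto intro!: integrable_real_indicator simp: emeasure_eq_measure)
      fix x assume x: "x \<in> space M"
      have "ln (\<delta> / ?k) = - ln (?k / \<delta>)" using \<delta> k by (simp add: ln_div)
      moreover have "ln (1 - \<delta>) \<le> 0" using \<delta> by simp
      ultimately show "?f (?Z x) \<le> - ln (1 - \<delta>) + indicator ?D x * ln (?k / \<delta>)"
        using x by (simp add: c_def indicator_def)
    qed
    also have "\<dots> = - ln (1 - \<delta>) + measure M ?D * ln (?k / \<delta>)"
      using D by (subst Bochner_Integration.integral_add)
        (auto intro!: integrable_real_indicator simp: emeasure_eq_measure prob_space)
    finally show ?thesis by (simp add: mult_left_mono)
  qed
  finally show ?thesis by simp
qed

section \<open>Cylinders and the approximation of measurable sets by them\<close>

locale config_system = mp_system \<mu> shift for \<mu> :: "('a::finite) config measure" +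
  assumes sets_mu: "sets \<mu> = sets config_space"
begin

lemma space_mu [simp]: "space \<mu> = UNIV"
  using sets_eq_imp_space_eq[OF sets_mu] by (simp add: config_space_def space_PiM)

lemma cyl_sets:
  assumes "finite J" shows "cyl J y \<in> sets \<mu>"
proof -
  have "(\<lambda>x. x j) \<in> measurable \<mu> (count_space UNIV)" for j
    unfolding measurable_cong_sets[OF sets_mu refl] config_space_def
    by (rule measurable_component_singleton) simp
  then have "(\<lambda>x. x j) -` {y j} \<inter> space \<mu> \<in> sets \<mu>" for j by (rule measurable_sets) simp
  then have "{x \<in> space \<mu>. x j = y j} \<in> sets \<mu>" for j by (simp add: vimage_def)
  then have "{x \<in> space \<mu>. \<forall>j\<in>J. x j = y j} \<in> sets \<mu>"
    by (intro sets.sets_Collect_finite_All assms)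
  then show ?thesis by (simp add: cyl_def)
qed

text \<open>Over a finite alphabet there are finitely many restrictions to \<open>J\<close>, and
  \<open>X\<close> factors through them, so each fibre is a finite union of cylinders.\<close>

lemma simple_function_depends_on:
  assumes J: "finite J" and X: "depends_on J X"
  shows "simple_function \<mu> X"
proof -
  let ?r = "\<lambda>x::'a config. restrict x J"
  have fin: "finite (?r ` S)" for S :: "'a config set"
    by (rule finite_subset[of _ "J \<rightarrow>\<^sub>E UNIV"]) (auto intro!: finite_PiE J)
  have Xr: "X (?r x) = X x" for x by (rule depends_onD[OF X]) simp
  have "X ` UNIV = X ` (?r ` UNIV)" by (auto simp: image_image Xr)
  then have "finite (X ` UNIV)" using fin[of UNIV] by simp
  moreover have "X -` {v} \<in> sets \<mu>" for v
  proof -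
    have "X -` {v} = (\<Union>w\<in>?r ` (X -` {v}). cyl J w)"
      using X by (auto simp: cyl_def depends_on_def)
    also have "\<dots> \<in> sets \<mu>" using fin cyl_sets[OF J] by (intro sets.finite_UN) auto
    finally show ?thesis .
  qed
  ultimately show ?thesis by (simp add: simple_function_def)
qed

lemma depends_on_sets:
  assumes "finite J" "depends_on J (\<lambda>x. x \<in> C)" shows "C \<in> sets \<mu>"
  using simple_function_fibre_sets[OF simple_function_depends_on[OF assms], of "{True}"]
  by (simp add: vimage_def)

text \<open>Partitions are \<open>nat\<close>-valued, so the finitely many patterns on the window
  are numbered by an injection.\<close>

lemma obtain_window_partition:
  assumes J: "finite J"
  obtains \<xi> where "fin_partition \<mu> \<xi>" "\<And>x y. \<xi> x = \<xi> y \<longleftrightarrow> (\<forall>j\<in>J. x j = y j)"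
proof -
  let ?r = "\<lambda>x::'a config. restrict x J"
  have "finite (range ?r)"
    by (rule finite_subset[of _ "J \<rightarrow>\<^sub>E UNIV"]) (auto intro!: finite_PiE J)
  from finite_imp_inj_to_nat_seg[OF this] obtain e :: "'a config \<Rightarrow> nat" where e: "inj_on e (range ?r)" by auto
  have iff: "e (?r x) = e (?r y) \<longleftrightarrow> (\<forall>j\<in>J. x j = y j)" for x y
  proof -
    have "e (?r x) = e (?r y) \<longleftrightarrow> ?r x = ?r y" using e by (auto dest: inj_onD)
    also have "\<dots> \<longleftrightarrow> (\<forall>j\<in>J. x j = y j)" by (auto simp: fun_eq_iff restrict_def)
    finally show ?thesis .
  qed
  show ?thesis
  proof (rule that[of "\<lambda>x. e (?r x)"])
    have "depends_on J (\<lambda>x. e (?r x))" unfolding depends_on_def using iff by blast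
    then show "fin_partition \<mu> (\<lambda>x. e (?r x))"
      by (rule simple_fin_partition[OF simple_function_depends_on[OF J]])
  qed (rule iff)
qed

text \<open>The sets that cylinder sets approximate in measure contain the one-coordinate generators
  and are closed under complement and countable union; a union is first cut off at a finite
  stage.\<close>

lemma approx_cylinder:
  assumes "A \<in> sets \<mu>" and "0 < \<epsilon>"
  obtains m :: nat and C where "depends_on {- int m..int m} (\<lambda>x. x \<in> C)"
    "measure \<mu> ((A - C) \<union> (C - A)) < \<epsilon>"
proof -
  let ?cyl = "\<lambda>m C. depends_on {- int m..int m} (\<lambda>x. x \<in> C)"
  let ?G = "{{f \<in> \<Pi>\<^sub>E i\<in>UNIV. space (count_space (UNIV::'a set)). f i \<in> A} |
      (i::int) A. i \<in> UNIV \<and> A \<in> sets (count_space (UNIV::'a set))}"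
  have sets: "sets \<mu> = sigma_sets UNIV ?G"
    unfolding sets_mu config_space_def sets_PiM_single by simp
  have cylS: "C \<in> sets \<mu>" if "?cyl m C" for m C
    using that by (intro depends_on_sets) auto
  \<comment> \<open>Quantifying over all \<epsilon> inside the induction lets the union case demand
    a smaller error from each piece.\<close>
  have "\<forall>\<epsilon>>0. \<exists>m C. ?cyl m C \<and> measure \<mu> ((A - C) \<union> (C - A)) < \<epsilon>"
    using assms(1) unfolding sets
  proof (induction A rule: sigma_sets.induct)
    case (Basic A)
    then obtain i B where A: "A = {f. f i \<in> B}" by auto
    have "?cyl (nat \<bar>i\<bar>) A" unfolding depends_on_def A by (auto dest!: bspec[where x = i])
    then show ?case by (intro allI impI exI[of _ "nat \<bar>i\<bar>"] exI[of _ A]) simp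
  next
    case Empty
    have "?cyl 0 {}" by (auto simp: depends_on_def)
    then show ?case by (intro allI impI exI[of _ 0] exI[of _ "{}"]) simp
  next
    case (Compl A)
    show ?case
    proof (intro allI impI)
      fix \<epsilon> :: real assume "0 < \<epsilon>"
      with Compl.IH obtain m C where C: "?cyl m C" "measure \<mu> ((A - C) \<union> (C - A)) < \<epsilon>" by blast
      have "?cyl m (- C)" using C(1) by (auto simp: depends_on_def)
      moreover have "((UNIV - A) - (- C)) \<union> (- C - (UNIV - A)) = (A - C) \<union> (C - A)" by auto
      ultimately show "\<exists>m C. ?cyl m C \<and> measure \<mu> (((UNIV - A) - C) \<union> (C - (UNIV - A))) < \<epsilon>"
        using C(2) by metis
    qed
  next
    case (Union a)
    have a: "a i \<in> sets \<mu>" for i using Union.hyps unfolding sets .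
    show ?case
    proof (intro allI impI)
      fix \<epsilon> :: real assume \<epsilon>: "0 < \<epsilon>"
      define U where "U n = (\<Union>i<n. a i)" for n
      have US: "U n \<in> sets \<mu>" for n unfolding U_def using a by blast
      have "(\<lambda>n. measure \<mu> (U n)) \<longlonglongrightarrow> measure \<mu> (\<Union>n. U n)"
        proof (rule finite_Lim_measure_incseq)
        show "incseq U" unfolding incseq_def U_def by (intro allI impI UN_mono) auto
      qed (use US in auto)
      moreover have UU: "(\<Union>n. U n) = (\<Union>i. a i)" unfolding U_def by blast
      ultimately have "(\<lambda>n. measure \<mu> (U n)) \<longlonglongrightarrow> measure \<mu> (\<Union>i. a i)" by simp
      then have "eventually (\<lambda>n. measure \<mu> (\<Union>i. a i) - \<epsilon> / 2 < measure \<mu> (U n)) sequentially"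
        using \<epsilon> by (intro order_tendstoD(1)) auto
      then obtain n where n: "measure \<mu> (\<Union>i. a i) - \<epsilon> / 2 < measure \<mu> (U n)"
        by (auto simp: eventually_sequentially)
      \<comment> \<open>The \<open>n\<close> pieces share one half of \<epsilon>, the cut-off takes
        the other; the \<open>+ 1\<close> keeps the denominator positive when
        \<open>n = 0\<close>.\<close>
      define \<epsilon>' where "\<epsilon>' = \<epsilon> / (2 * (real n + 1))"
      have \<epsilon>': "0 < \<epsilon>'" using \<epsilon> by (simp add: \<epsilon>'_def)
      have "\<forall>i. \<exists>m C. ?cyl m C \<and> measure \<mu> ((a i - C) \<union> (C - a i)) < \<epsilon>'"
        using Union.IH \<epsilon>' by blast
      then obtain m C where
        C: "\<And>i. ?cyl (m i) (C i)" "\<And>i. measure \<mu> ((a i - C i) \<union> (C i - a i)) < \<epsilon>'"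
        unfolding choice_iff by blast
      define N where "N = (\<Sum>i<n. m i)"
      define D where "D = (\<Union>i<n. C i)"
      have "?cyl N (C i)" if "i < n" for i
      proof (rule depends_on_mono[OF C(1)])
        have "m i \<le> N" unfolding N_def using that by (intro member_le_sum) auto
        then show "{- int (m i)..int (m i)} \<subseteq> {- int N..int N}" by auto
      qed
      then have D: "?cyl N D" unfolding D_def depends_on_def by blast
      let ?S = "\<lambda>i. (a i - C i) \<union> (C i - a i)"
      have S: "?S i \<in> sets \<mu>" for i using a cylS[OF C(1)] by auto
      have aS: "(\<Union>i. a i) \<in> sets \<mu>" using a by blast
      have "measure \<mu> (((\<Union>i. a i) - D) \<union> (D - (\<Union>i. a i)))
          \<le> measure \<mu> (((\<Union>i. a i) - U n) \<union> (\<Union>i<n. ?S i))"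
        using aS US S by (intro finite_measure_mono) (auto simp: D_def U_def)
      also have "\<dots> \<le> measure \<mu> ((\<Union>i. a i) - U n) + measure \<mu> (\<Union>i<n. ?S i)"
        using aS US S by (intro measure_Un_le) auto
      also have "measure \<mu> ((\<Union>i. a i) - U n) = measure \<mu> (\<Union>i. a i) - measure \<mu> (U n)"
        using aS US UU by (intro finite_measure_Diff) auto
      also have "measure \<mu> (\<Union>i<n. ?S i) \<le> (\<Sum>i<n. measure \<mu> (?S i))"
        using S by (intro finite_measure_subadditive_finite) auto
      also have "\<dots> \<le> (\<Sum>i<n. \<epsilon>')" using C(2) by (intro sum_mono less_imp_le)
      also have "\<dots> \<le> \<epsilon> / 2" using \<epsilon> by (simp add: \<epsilon>'_def field_simps)
      finally have "measure \<mu> (((\<Union>i. a i) - D) \<union> (D - (\<Union>i. a i))) < \<epsilon>" using n by simp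
      with D show "\<exists>m C. ?cyl m C \<and> measure \<mu> (((\<Union>i. a i) - C) \<union> (C - (\<Union>i. a i))) < \<epsilon>" by blast
    qed
  qed
  with assms(2) that show ?thesis by blast
qed

text \<open>Each fibre is approximated separately. The values stay in \<open>range \<xi>\<close> so
  that both itineraries are words over one finite alphabet, as the perturbation bound
  requires.\<close>

lemma approx_partition:
  assumes \<xi>: "fin_partition \<mu> \<xi>" and \<epsilon>: "0 < \<epsilon>"
  obtains m :: nat and \<zeta> where "depends_on {- int m..int m} \<zeta>" "range \<zeta> \<subseteq> range \<xi>"
    "measure \<mu> {x. \<xi> x \<noteq> \<zeta> x} < \<epsilon>"
proof -
  let ?R = "range \<xi>"
  have R: "finite ?R" using \<xi> by (simp add: fin_partition_def)
  have fib: "\<xi> -` {v} \<in> sets \<mu>" for v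
    using simple_function_fibre_sets[OF fin_partition_simple[OF \<xi>], of "{v}"] by simp
  define k where "k = real (card ?R)"
  have k: "0 < k" using R by (simp add: k_def card_gt_0_iff)
  have "\<exists>m C. depends_on {- int m..int m} (\<lambda>x. x \<in> C)
      \<and> measure \<mu> ((\<xi> -` {v} - C) \<union> (C - \<xi> -` {v})) < \<epsilon> / k" for v
    using approx_cylinder[OF fib, of "\<epsilon> / k" v] \<epsilon> k by (metis divide_pos_pos)
  then obtain m C where C: "\<And>v. depends_on {- int (m v)..int (m v)} (\<lambda>x. x \<in> C v)"
      "\<And>v. measure \<mu> ((\<xi> -` {v} - C v) \<union> (C v - \<xi> -` {v})) < \<epsilon> / k" by metis
  define N where "N = (\<Sum>v\<in>?R. m v)"
  have CN: "depends_on {- int N..int N} (\<lambda>x. x \<in> C v)" if "v \<in> ?R" for v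
  proof (rule depends_on_mono[OF C(1)])
    have "m v \<le> N" unfolding N_def using that R by (intro member_le_sum) auto
    then show "{- int (m v)..int (m v)} \<subseteq> {- int N..int N}" by auto
  qed
  \<comment> \<open>The sets \<open>C v\<close> may overlap or leave gaps, but outside the symmetric
    differences exactly one of them contains the point. Choice and default therefore only act on the
    small set; the default merely stays in the range.\<close>
  define \<zeta> where "\<zeta> x = (if \<exists>v\<in>?R. x \<in> C v then SOME v. v \<in> ?R \<and> x \<in> C v else \<xi> undefined)" for x
  have "depends_on {- int N..int N} \<zeta>"
    unfolding depends_on_def
  proof (intro allI impI)
    fix x y :: "'a config" assume "\<forall>j\<in>{- int N..int N}. x j = y j"
    then have "(v \<in> ?R \<and> x \<in> C v) = (v \<in> ?R \<and> y \<in> C v)" for v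
      using CN unfolding depends_on_def by blast
    then show "\<zeta> x = \<zeta> y" unfolding \<zeta>_def Bex_def by presburger
  qed
  moreover have some: "(SOME v. v \<in> ?R \<and> x \<in> C v) \<in> ?R \<and> x \<in> C (SOME v. v \<in> ?R \<and> x \<in> C v)"
    if "\<exists>v\<in>?R. x \<in> C v" for x
    using that by (intro someI_ex[of "\<lambda>v. v \<in> ?R \<and> x \<in> C v"]) blast
  then have "range \<zeta> \<subseteq> ?R" by (auto simp: \<zeta>_def)
  moreover have "measure \<mu> {x. \<xi> x \<noteq> \<zeta> x} < \<epsilon>"
  proof -
    let ?S = "\<lambda>v. (\<xi> -` {v} - C v) \<union> (C v - \<xi> -` {v})"
    have S: "?S v \<in> sets \<mu>" for v using fib depends_on_sets[OF _ C(1)] by auto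
    have "{x. \<xi> x \<noteq> \<zeta> x} \<subseteq> (\<Union>v\<in>?R. ?S v)"
    proof (rule subsetI, rule ccontr)
      fix x assume "x \<in> {x. \<xi> x \<noteq> \<zeta> x}" and no: "x \<notin> (\<Union>v\<in>?R. ?S v)"
      then have iff: "x \<in> C v \<longleftrightarrow> \<xi> x = v" if "v \<in> ?R" for v using that by blast
      then have "\<exists>v\<in>?R. x \<in> C v" by auto
      with some[OF this] iff have "\<zeta> x = \<xi> x" by (auto simp: \<zeta>_def)
      with \<open>x \<in> {x. \<xi> x \<noteq> \<zeta> x}\<close> show False by simp
    qed
    then have "measure \<mu> {x. \<xi> x \<noteq> \<zeta> x} \<le> measure \<mu> (\<Union>v\<in>?R. ?S v)"
      using S R by (intro finite_measure_mono sets.finite_UN) auto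
    also have "\<dots> \<le> (\<Sum>v\<in>?R. measure \<mu> (?S v))"
      using S R by (intro finite_measure_subadditive_finite) auto
    also have "\<dots> < (\<Sum>v\<in>?R. \<epsilon> / k)" using C(2) R by (intro sum_strict_mono) auto
    also have "\<dots> = \<epsilon>" using k by (simp add: k_def)
    finally show ?thesis .
  qed
  ultimately show ?thesis by (rule that)
qed

section \<open>Stationarity of words and the coordinate generator\<close>

lemma word_simple: "simple_function \<mu> (word a n)"
  by (rule simple_function_depends_on[of "{a..<a + int n}"]) (auto simp: depends_on_def word_eq_iff)

text \<open>Iterates of the shift move windows to the right only, so a negative start is carried up
  to 0 rather than 0 down to it.\<close>

lemma measure_word: "measure \<mu> {x. R (word a n x)} = measure \<mu> {x. R (word 0 n x)}"
proof -
  have shiftw: "measure \<mu> {x. R (word (b + int i) n x)} = measure \<mu> {x. R (word b n x)}" for b i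
    using measure_funpow_vimage[OF simple_function_fibre_sets[OF word_simple[of b n], of "{w. R w}"], of i]
    by (simp add: vimage_def word_funpow_shift)
  show ?thesis
    using shiftw[of 0 "nat a"] shiftw[of a "nat (- a)"] by (cases "0 \<le> a") auto
qed

lemma fibre_prob_word: "fibre_prob \<mu> (word a n) = fibre_prob \<mu> (word 0 n)"
proof
  fix v
  have "word b n -` {v} \<inter> space \<mu> = {x. word b n x = v}" for b by auto
  then show "fibre_prob \<mu> (word a n) v = fibre_prob \<mu> (word 0 n) v"
    unfolding fibre_prob_def by (simp only: measure_word[of "\<lambda>w. w = v" a])
qed

lemma part_entropy_word: "part_entropy \<mu> (word a n) = part_entropy \<mu> (word 0 n)"
proof -
  have shiftw: "part_entropy \<mu> (word (b + int i) n) = part_entropy \<mu> (word b n)" for b i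
    using part_entropy_funpow[OF word_simple[of b n], of i] by (simp add: word_funpow_shift)
  show ?thesis
    using shiftw[of 0 "nat a"] shiftw[of a "nat (- a)"] by (cases "0 \<le> a") auto
qed

text \<open>Kolmogorov-Sinai for the coordinate at 0: a partition is replaced by a close one that
  sees a bounded window, whose itinerary is a function of a slightly longer word. In particular the
  supremum is finite and attained.\<close>

lemma ks_entropy_shift:
  obtains h where "ks_entropy \<mu> shift = ereal h" "0 \<le> h"
    "(\<lambda>n. part_entropy \<mu> (word 0 n) / real n) \<longlonglongrightarrow> h"
    "\<And>n. 0 < n \<Longrightarrow> h \<le> part_entropy \<mu> (word 0 n) / real n"
proof -
  obtain \<alpha> where \<alpha>: "fin_partition \<mu> \<alpha>" "\<And>x y. \<alpha> x = \<alpha> y \<longleftrightarrow> (\<forall>j\<in>{0}. x j = y j)"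
    using obtain_window_partition[of "{0}"] by auto
  define h where "h = entropy_rel \<mu> shift \<alpha>"
  have "itinerary shift \<alpha> n x = itinerary shift \<alpha> n y \<longleftrightarrow> word 0 n x = word 0 n y" for n x y
    by (auto simp: itinerary_def word_def funpow_shift \<alpha>(2))
  then have it: "part_entropy \<mu> (itinerary shift \<alpha> n) = part_entropy \<mu> (word 0 n)" for n
    by (intro part_entropy_cong word_simple itinerary_simple \<alpha>(1)) simp
  note lim = entropy_rel_limit[OF \<alpha>(1), unfolded it, folded h_def]
  have "entropy_rel \<mu> shift \<xi> \<le> h" if \<xi>: "fin_partition \<mu> \<xi>" for \<xi>
  proof (rule field_le_epsilon)
    fix e :: real assume e: "0 < e"
    let ?R = "range \<xi>"
    define k where "k = real (card ?R)"
    have R: "finite ?R" using \<xi> by (simp add: fin_partition_def)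
    have k: "1 \<le> k" unfolding k_def using R by (simp add: Suc_leI card_gt_0_iff)
    \<comment> \<open>Solves \<open>- ln (1 - \<delta>) = e / 2\<close>. The disagreement
      probability is fixed afterwards, small against \<open>ln (k / \<delta>)\<close>, to pay the
      other half; the \<open>+ 1\<close> there guards against a zero logarithm.\<close>
    define \<delta> where "\<delta> = 1 - exp (- (e / 2))"
    have \<delta>: "0 < \<delta>" "\<delta> < 1" "- ln (1 - \<delta>) = e / 2" using e by (auto simp: \<delta>_def)
    have lk: "0 \<le> ln (k / \<delta>)" using \<delta> k by (intro ln_ge_zero) (simp add: field_simps)
    obtain m \<zeta> where \<zeta>: "depends_on {- int m..int m} \<zeta>" "range \<zeta> \<subseteq> range \<xi>"
      "measure \<mu> {x. \<xi> x \<noteq> \<zeta> x} < e / (2 * (ln (k / \<delta>) + 1))"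
      using approx_partition[OF \<xi>, of "e / (2 * (ln (k / \<delta>) + 1))"] e lk by auto
    have "measure \<mu> {x. \<xi> x \<noteq> \<zeta> x} * ln (k / \<delta>) \<le> e / (2 * (ln (k / \<delta>) + 1)) * ln (k / \<delta>)"
      using \<zeta>(3) lk by (intro mult_right_mono) auto
    also have "\<dots> \<le> e / 2" using lk e by (simp add: field_simps)
    finally have small: "- ln (1 - \<delta>) + measure \<mu> {x. \<xi> x \<noteq> \<zeta> x} * ln (k / \<delta>) \<le> e"
      using \<delta> by simp
    have \<zeta>p: "fin_partition \<mu> \<zeta>"
      by (intro simple_fin_partition simple_function_depends_on[OF _ \<zeta>(1)]) simp
    \<comment> \<open>\<open>n\<close> translates of the window from \<open>-m\<close> to
      \<open>m\<close> cover \<open>n + 2 * m\<close> coordinates, and the excess disappears in the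
      quotient.\<close>
    have bound: "part_entropy \<mu> (itinerary shift \<xi> n) / real n
        \<le> part_entropy \<mu> (word 0 (n + 2 * m)) / real (n + 2 * m) * (real (n + 2 * m) / real n) + e"
      if n: "0 < n" for n
    proof -
      have fac: "itinerary shift \<zeta> n x = itinerary shift \<zeta> n y"
        if "word (- int m) (n + 2 * m) x = word (- int m) (n + 2 * m) y" for x y
      proof -
        have "\<zeta> ((shift ^^ i) x) = \<zeta> ((shift ^^ i) y)" if "i < n" for i
          using \<open>word _ _ x = _\<close> that unfolding word_eq_iff
          by (intro depends_onD[OF \<zeta>(1)]) (auto simp: funpow_shift)
        then show ?thesis by (simp add: itinerary_def)
      qed
      have "part_entropy \<mu> (itinerary shift \<xi> n) \<le> part_entropy \<mu> (itinerary shift \<zeta> n)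
          + real n * (- ln (1 - \<delta>) + measure \<mu> {x. \<xi> x \<noteq> \<zeta> x} * ln (k / \<delta>))"
        using part_entropy_itinerary_perturb[OF \<xi> \<zeta>p R _ _ \<delta>(1,2), of n] \<zeta>(2) by (simp add: k_def)
      also have "\<dots> \<le> part_entropy \<mu> (itinerary shift \<zeta> n) + real n * e"
        using small by (intro add_left_mono mult_left_mono) auto
      also have "part_entropy \<mu> (itinerary shift \<zeta> n) \<le> part_entropy \<mu> (word (- int m) (n + 2 * m))"
        using fac by (intro part_entropy_mono word_simple itinerary_simple \<zeta>p)
      also have "\<dots> = part_entropy \<mu> (word 0 (n + 2 * m))" by (rule part_entropy_word)
      finally have "part_entropy \<mu> (itinerary shift \<xi> n) / real n
          \<le> (part_entropy \<mu> (word 0 (n + 2 * m)) + real n * e) / real n"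
        by (intro divide_right_mono) auto
      moreover have "p / real (n + 2 * m) * (real (n + 2 * m) / real n) = p / real n" for p
        using n by (simp del: of_nat_add)
      ultimately show ?thesis using n by (simp add: add_divide_distrib)
    qed
    have "(\<lambda>n. real (n + 2 * m) / real n) \<longlonglongrightarrow> 1"
      by real_asymp
    then have "(\<lambda>n. part_entropy \<mu> (word 0 (n + 2 * m)) / real (n + 2 * m) * (real (n + 2 * m) / real n) + e)
        \<longlonglongrightarrow> h * 1 + e"
      by (intro tendsto_intros LIMSEQ_ignore_initial_segment[OF lim(1)])
    then show "entropy_rel \<mu> shift \<xi> \<le> h + e"
      using bound by (intro LIMSEQ_le[OF entropy_rel_limit(1)[OF \<xi>]]) (auto intro!: exI[of _ 1])
  qed
  then have "ks_entropy \<mu> shift = ereal h"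
    unfolding ks_entropy_def h_def using \<alpha>(1) by (intro antisym SUP_least SUP_upper2[of \<alpha>]) auto
  moreover have "0 \<le> h" unfolding h_def by (rule entropy_rel_nonneg[OF \<alpha>(1)])
  ultimately show ?thesis using lim that by blast
qed

end

subsection \<open>Markov approximation\<close>

context config_system
begin

text \<open>By stationarity a word has a probability of its own, independent of where it is read;
  position 0 is just a representative.\<close>

definition word_prob :: "'a list \<Rightarrow> real" where
  "word_prob w = fibre_prob \<mu> (word 0 (length w)) w"

lemma word_prob_word: "word_prob (word a n x) = fibre_prob \<mu> (word a n) (word a n x)"
  by (simp add: word_prob_def fibre_prob_word[of a])

lemma word_prob_nonneg [simp]: "0 \<le> word_prob w"
  by (simp add: word_prob_def)

text \<open>Summing out the first letter leaves the word read at position 1, which has the same law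
  as at position 0.\<close>

lemma sum_word_prob_Cons: "(\<Sum>a\<in>UNIV. word_prob (a # u)) = word_prob u"
proof -
  let ?n = "length u"
  let ?A = "\<lambda>a. word 0 (Suc ?n) -` {a # u}"
  have "(\<Sum>a\<in>UNIV. word_prob (a # u)) = (\<Sum>a\<in>UNIV. measure \<mu> (?A a))"
    by (simp add: word_prob_def fibre_prob_def)
  also have "\<dots> = measure \<mu> (\<Union>a\<in>UNIV. ?A a)"
    using simple_function_fibre_sets[OF word_simple]
    by (intro finite_measure_finite_Union[symmetric]) (auto simp: disjoint_family_on_def)
  also have "(\<Union>a\<in>UNIV. ?A a) = word 1 ?n -` {u}" by (auto simp: word_Suc)
  also have "measure \<mu> \<dots> = word_prob u"
    using fibre_prob_word[of 1 ?n] by (simp add: word_prob_def fibre_prob_def fun_eq_iff)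
  finally show ?thesis .
qed

text \<open>The Markov approximation of order \<open>k\<close>, run backwards in time; the last \<open>k\<close>
  letters are uniform.\<close>

primrec markov_prob :: "nat \<Rightarrow> 'a list \<Rightarrow> real" where
  "markov_prob k [] = 1"
| "markov_prob k (a # w) = (if k \<le> length w then word_prob (a # take k w) / word_prob (take k w)
     else 1 / real CARD('a)) * markov_prob k w"

lemma markov_prob_nonneg [simp]: "0 \<le> markov_prob k w"
  by (induction w) auto

lemma finite_words [simp]: "finite {w::'a list. length w = n}"
  using finite_lists_length_eq[of "UNIV :: 'a set" n] by simp

text \<open>Each transition weight sums to 1 over the new letter, or to 0 after a context of
  probability 0, where division returns 0. This is why a sub-probability is stated.\<close>

lemma sum_markov_prob_le_1: "(\<Sum>w\<in>{w. length w = n}. markov_prob k w) \<le> 1"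
proof (induction n)
  case (Suc n)
  let ?L = "{w::'a list. length w = n}"
  let ?c = "\<lambda>a w. if k \<le> length w then word_prob (a # take k w) / word_prob (take k w)
     else 1 / real CARD('a)"
  have eq: "{w::'a list. length w = Suc n} = (\<lambda>(w, a). a # w) ` (?L \<times> UNIV)"
    by (auto simp: length_Suc_conv image_iff)
  have inj: "inj_on (\<lambda>(w, a). a # w) (?L \<times> (UNIV :: 'a set))" by (auto simp: inj_on_def)
  have "(\<Sum>w\<in>{w::'a list. length w = Suc n}. markov_prob k w)
      = (\<Sum>w\<in>?L. (\<Sum>a\<in>UNIV. ?c a w) * markov_prob k w)"
    unfolding eq sum.reindex[OF inj] sum_distrib_right sum.cartesian_product
    by (rule sum.cong) auto
  also have "\<dots> \<le> (\<Sum>w\<in>?L. 1 * markov_prob k w)"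
  proof (intro sum_mono mult_right_mono)
    fix w :: "'a list"
    show "(\<Sum>a\<in>UNIV. ?c a w) \<le> 1"
      by (cases "k \<le> length w")
        (simp_all add: sum_divide_distrib[symmetric] sum_word_prob_Cons divide_self_if)
  qed auto
  finally show ?case using Suc by simp
qed simp

text \<open>The context lies to the right, matching the direction of \<open>markov_prob\<close>.
  Moving \<open>a\<close> amounts to shifting \<open>x\<close>, which turns sums over positions into
  Birkhoff sums.\<close>

definition cond_info :: "nat \<Rightarrow> int \<Rightarrow> 'a config \<Rightarrow> real" where
  "cond_info k a x = - ln (word_prob (word a (Suc k) x) / word_prob (word (a + 1) k x))"

lemma AE_word_prob_pos: "AE x in \<mu>. \<forall>a n. 0 < word_prob (word a n x)"
  unfolding AE_all_countable word_prob_word by (intro allI AE_fibre_prob_pos word_simple)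

text \<open>Letters are peeled off from the left: the first \<open>n - k\<close> have a full
  context, the other \<open>min k n\<close> are uniform. Truncated subtraction covers words shorter
  than the order.\<close>

lemma ln_markov_prob_word:
  assumes pos: "\<And>a n. 0 < word_prob (word a n x)"
  shows "0 < markov_prob k (word a n x) \<and> - ln (markov_prob k (word a n x))
    = (\<Sum>i<n - k. cond_info k (a + int i) x) + real (min k n) * ln (real CARD('a))"
proof (induction n arbitrary: a)
  case (Suc n)
  let ?m = "markov_prob k (word (a + 1) n x)"
  show ?case
  proof (cases "k \<le> n")
    case True
    define c where "c = word_prob (word a (Suc k) x) / word_prob (word (a + 1) k x)"
    have c: "0 < c" "cond_info k a x = - ln c" using pos by (simp_all add: c_def cond_info_def)
    have eq: "markov_prob k (word a (Suc n) x) = c * ?m"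
      using True by (simp add: word_Suc take_word c_def)
    have "(\<Sum>i<Suc n - k. cond_info k (a + int i) x)
        = cond_info k a x + (\<Sum>i<n - k. cond_info k (a + 1 + int i) x)"
      using True by (simp add: Suc_diff_le sum.lessThan_Suc_shift algebra_simps del: sum.lessThan_Suc)
    moreover have "ln (c * ?m) = ln c + ln ?m" using c Suc[of "a + 1"] by (intro ln_mult_pos) auto
    ultimately show ?thesis unfolding eq using Suc[of "a + 1"] c True by auto
  next
    case False
    have eq: "markov_prob k (word a (Suc n) x) = 1 / real CARD('a) * ?m"
      using False by (simp add: word_Suc)
    have "ln (1 / real CARD('a) * ?m) = ln (1 / real CARD('a)) + ln ?m"
      using Suc[of "a + 1"] by (intro ln_mult_pos) auto
    moreover have "min k n = n" "min k (Suc n) = Suc n" using False by auto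
    ultimately show ?thesis unfolding eq using Suc[of "a + 1"] False
      by (auto simp: ln_div algebra_simps)
  qed
qed simp

lemma cond_info_simple: "simple_function \<mu> (cond_info k a)"
proof (rule simple_function_depends_on[of "{a..<a + int (Suc k)}"])
  show "depends_on {a..<a + int (Suc k)} (cond_info k a)"
    unfolding depends_on_def
  proof (intro allI impI)
    fix x y :: "'a config" assume "\<forall>j\<in>{a..<a + int (Suc k)}. x j = y j"
    then have "word a (Suc k) x = word a (Suc k) y" "word (a + 1) k x = word (a + 1) k y"
      by (auto simp: word_eq_iff)
    then show "cond_info k a x = cond_info k a y" by (simp add: cond_info_def)
  qed
qed simp

lemma integral_cond_info:
  "(\<integral>x. cond_info k a x \<partial>\<mu>) = part_entropy \<mu> (word 0 (Suc k)) - part_entropy \<mu> (word 0 k)"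
proof -
  note int = integrable_simple_comp[OF word_simple]
  have "(\<integral>x. cond_info k a x \<partial>\<mu>)
      = (\<integral>x. - ln (word_prob (word a (Suc k) x)) - - ln (word_prob (word (a + 1) k x)) \<partial>\<mu>)"
  proof (rule integral_cong_AE)
    show "AE x in \<mu>. cond_info k a x
        = - ln (word_prob (word a (Suc k) x)) - - ln (word_prob (word (a + 1) k x))"
      using AE_word_prob_pos
    proof eventually_elim
      case (elim x)
      then have "0 < word_prob (word a (Suc k) x)" "0 < word_prob (word (a + 1) k x)" by blast+
      then show ?case unfolding cond_info_def by (simp add: ln_div)
    qed
    show "cond_info k a \<in> borel_measurable \<mu>"
      by (rule borel_measurable_simple_function[OF cond_info_simple])
  qed (intro borel_measurable_diff simple_function_measurable_comp[OF word_simple,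
      of "\<lambda>w. - ln (word_prob w)"])
  also have "\<dots> = (\<integral>x. - ln (word_prob (word a (Suc k) x)) \<partial>\<mu>) - (\<integral>x. - ln (word_prob (word (a + 1) k x)) \<partial>\<mu>)"
    by (rule Bochner_Integration.integral_diff) (rule int[of "\<lambda>w. - ln (word_prob w)"])+
  also have "\<dots> = part_entropy \<mu> (word a (Suc k)) - part_entropy \<mu> (word (a + 1) k)"
    unfolding part_entropy_eq_integral[OF word_simple] word_prob_word ..
  finally show ?thesis unfolding part_entropy_word[of a] part_entropy_word[of "a + 1"] .
qed

text \<open>Words much less probable under \<mu> than under the Markov law have small total mass,
  because the Markov masses sum to at most 1. Off those words the information exceeds the Markov
  information only slightly, and the latter is governed by a mean below
  \<open>h + \<epsilon> / 2\<close> for a suitable order \<open>k\<close>.\<close>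

lemma word_prob_lower:
  assumes erg: "ergodic \<mu> shift" and h: "0 \<le> h"
    and lim: "(\<lambda>n. part_entropy \<mu> (word 0 n) / real n) \<longlonglongrightarrow> h"
    and \<epsilon>: "0 < \<epsilon>"
  shows "(\<lambda>n. measure \<mu> {x. word_prob (word 0 n x) < exp (- ((h + \<epsilon>) * real n))}) \<longlonglongrightarrow> 0"
proof -
  let ?H = "\<lambda>n. part_entropy \<mu> (word 0 n)"
  \<comment> \<open>If every increment of the block entropy were at least
    \<open>h + \<epsilon> / 2\<close>, the block entropies would grow faster than their limit rate
    \<open>h\<close>. The increment is the mean of \<open>cond_info k\<close>.\<close>
  have "\<exists>k. ?H (Suc k) - ?H k < h + \<epsilon> / 2"
  proof (rule ccontr)
    assume "\<nexists>k. ?H (Suc k) - ?H k < h + \<epsilon> / 2"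
    then have step: "?H k + (h + \<epsilon> / 2) \<le> ?H (Suc k)" for k by (auto simp: not_less algebra_simps)
    have "real n * (h + \<epsilon> / 2) \<le> ?H n" for n
    proof (induction n)
      case 0
      show ?case by (simp add: part_entropy_nonneg)
    next
      case (Suc n)
      have "real (Suc n) * (h + \<epsilon> / 2) = real n * (h + \<epsilon> / 2) + (h + \<epsilon> / 2)"
        by (simp add: algebra_simps)
      with Suc step[of n] show ?case by linarith
    qed
    then have "h + \<epsilon> / 2 \<le> ?H n / real n" if "0 < n" for n
      using that by (simp add: pos_le_divide_eq mult.commute)
    then have "h + \<epsilon> / 2 \<le> h"
      by (intro LIMSEQ_le_const[OF lim]) (auto intro!: exI[of _ 1])
    with \<epsilon> show False by simp
  qed
  then obtain k where k: "?H (Suc k) - ?H k < h + \<epsilon> / 2" by blast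
  define g where "g x = cond_info k 0 x - (h + \<epsilon> / 2)" for x
  have g_simple: "simple_function \<mu> g"
    using simple_function_compose1[OF cond_info_simple[of k 0], of "\<lambda>t. t - (h + \<epsilon> / 2)"]
    by (simp add: g_def[abs_def])
  have "finite (range (\<lambda>x. \<bar>g x\<bar>))"
    using simple_function_compose1[OF g_simple, of abs] by (simp add: simple_function_def)
  then have "bdd_above (range (\<lambda>x. \<bar>g x\<bar>))" by (rule bdd_above_finite)
  then obtain B where B: "\<And>x. \<bar>g x\<bar> \<le> B" by (auto simp: bdd_above_def)
  interpret G: bounded_observable \<mu> shift g B
    using B borel_measurable_simple_function[OF g_simple] by unfold_locales auto
  have "(\<integral>x. g x \<partial>\<mu>) < 0"
    unfolding g_def using integrable_simple_comp[OF cond_info_simple[of k 0], of "\<lambda>t. t"] k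
    by (simp add: integral_cond_info prob_space[simplified])
  then have D0: "(\<lambda>n. measure \<mu> {x \<in> space \<mu>. \<epsilon> / 8 * real n < birkhoff_sum shift g n x}) \<longlonglongrightarrow> 0"
    using \<epsilon> by (intro G.birkhoff_sum_small erg) auto
  \<comment> \<open>The budget \<open>\<epsilon> * n\<close> is spent as follows: one half on the
    centring in \<open>g\<close>, a quarter on \<open>Q\<close>, an eighth on the Birkhoff sum in
    \<open>D\<close>, an eighth on the \<open>k\<close> uniform letters.\<close>
  define D where "D n = {x. \<epsilon> / 8 * real n < birkhoff_sum shift g n x}" for n
  have D: "(\<lambda>n. measure \<mu> (D n)) \<longlonglongrightarrow> 0" using D0 by (simp add: D_def)
  have DS: "D n \<in> sets \<mu>" for n
  proof -
    have "(\<lambda>x. birkhoff_sum shift g n x) \<in> borel_measurable \<mu>"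
      unfolding birkhoff_sum_def
      by (intro borel_measurable_sum measurable_compose[OF funpow_measurable G.g_meas])
    then have "{x \<in> space \<mu>. \<epsilon> / 8 * real n < birkhoff_sum shift g n x} \<in> sets \<mu>" by measurable
    then show ?thesis by (simp add: D_def)
  qed
  define Q where "Q n = {x. word_prob (word 0 n x) < exp (- (\<epsilon> / 4 * real n)) * markov_prob k (word 0 n x)}" for n
  have QS: "Q n \<in> sets \<mu>" for n
    using simple_function_fibre_sets[OF word_simple[of 0 n],
        of "{w. word_prob w < exp (- (\<epsilon> / 4 * real n)) * markov_prob k w}"]
    by (simp add: Q_def vimage_def)
  have Q: "measure \<mu> (Q n) \<le> exp (- (\<epsilon> / 4 * real n))" for n
  proof -
    let ?t = "exp (- (\<epsilon> / 4 * real n))"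
    let ?i = "\<lambda>w. if word_prob w < ?t * markov_prob k w then 1 else 0 :: real"
    have "measure \<mu> (Q n) = (\<integral>x. ?i (word 0 n x) \<partial>\<mu>)"
    proof -
      have "(\<integral>x. ?i (word 0 n x) \<partial>\<mu>) = (\<integral>x. indicator (Q n) x \<partial>\<mu>)"
        by (intro Bochner_Integration.integral_cong) (auto simp: Q_def)
      then show ?thesis using QS by simp
    qed
    also have "\<dots> = (\<Sum>w\<in>range (word 0 n). ?i w * fibre_prob \<mu> (word 0 n) w)"
      using integral_simple_comp[OF word_simple, of ?i 0 n] by simp
    also have "\<dots> \<le> (\<Sum>w\<in>range (word 0 n). ?t * markov_prob k w)"
      by (intro sum_mono) (auto simp: word_prob_word[symmetric])
    also have "\<dots> \<le> (\<Sum>w\<in>{w. length w = n}. ?t * markov_prob k w)"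
      by (intro sum_mono2) auto
    also have "\<dots> \<le> ?t"
      using sum_markov_prob_le_1[of k n] by (simp add: sum_distrib_left[symmetric])
    finally show ?thesis .
  qed
  let ?lA = "ln (real CARD('a))"
  obtain n0 where n0: "8 * real k * ?lA / \<epsilon> < real n0" using reals_Archimedean2 by blast
  have main: "measure \<mu> {x. word_prob (word 0 n x) < exp (- ((h + \<epsilon>) * real n))}
      \<le> exp (- (\<epsilon> / 4 * real n)) + measure \<mu> (D (n - k))" if n: "max n0 k \<le> n" for n
  proof -
    let ?bad = "{x. word_prob (word 0 n x) < exp (- ((h + \<epsilon>) * real n))}"
    have "AE x in \<mu>. x \<in> ?bad \<longrightarrow> x \<in> Q n \<union> D (n - k)"
      using AE_word_prob_pos
    proof eventually_elim
      case (elim x)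
      show ?case
      proof (intro impI)
        assume bad: "x \<in> ?bad"
        show "x \<in> Q n \<union> D (n - k)"
        proof (cases "x \<in> Q n")
          case False
          let ?q = "markov_prob k (word 0 n x)"
          have q: "0 < ?q" "- ln ?q = (\<Sum>i<n - k. cond_info k (int i) x) + real k * ?lA"
            using ln_markov_prob_word[of x k 0 n] elim n by (auto simp: min_def)
          have "exp (- (\<epsilon> / 4 * real n)) * ?q \<le> word_prob (word 0 n x)" using False by (simp add: Q_def)
          also have "\<dots> < exp (- ((h + \<epsilon>) * real n))" using bad by simp
          finally have "ln (exp (- (\<epsilon> / 4 * real n)) * ?q) < ln (exp (- ((h + \<epsilon>) * real n)))"
            using q by (subst ln_less_cancel_iff) auto
          then have "(h + \<epsilon>) * real n - \<epsilon> / 4 * real n < - ln ?q" using q(1) by (simp add: ln_mult)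
          then have *: "(h + \<epsilon>) * real n - \<epsilon> / 4 * real n < (\<Sum>i<n - k. cond_info k (int i) x) + real k * ?lA"
            unfolding q(2) .
          have shifted: "cond_info k 0 ((shift ^^ i) x) = cond_info k (int i) x" for i
            by (simp add: cond_info_def word_funpow_shift add.commute)
          have "birkhoff_sum shift g (n - k) x
              = (\<Sum>i<n - k. cond_info k (int i) x) - real (n - k) * (h + \<epsilon> / 2)"
            by (simp add: birkhoff_sum_def g_def shifted sum_subtractf)
          moreover have "real (n - k) * (h + \<epsilon> / 2) \<le> real n * (h + \<epsilon> / 2)"
            using h \<epsilon> by (intro mult_right_mono) auto
          moreover have "real k * ?lA \<le> \<epsilon> / 8 * real n"
          proof -
            have "8 * real k * ?lA / \<epsilon> \<le> real n" using n0 n by linarith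
            then show ?thesis using \<epsilon> by (simp add: field_simps)
          qed
          moreover have "\<epsilon> / 8 * real (n - k) \<le> \<epsilon> / 8 * real n"
            using \<epsilon> by (intro mult_left_mono) auto
          ultimately have "\<epsilon> / 8 * real (n - k) < birkhoff_sum shift g (n - k) x"
            using * by (simp add: algebra_simps)
          then show ?thesis by (simp add: D_def)
        qed simp
      qed
    qed
    then have "measure \<mu> ?bad \<le> measure \<mu> (Q n \<union> D (n - k))"
      using QS DS by (intro finite_measure_mono_AE) auto
    also have "\<dots> \<le> measure \<mu> (Q n) + measure \<mu> (D (n - k))"
      using QS DS by (intro measure_Un_le)
    finally show ?thesis using Q[of n] by linarith
  qed
  have "(\<lambda>n. measure \<mu> (D (n - k))) \<longlonglongrightarrow> 0"
    by (rule LIMSEQ_offset[of _ k]) (simp add: D)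
  moreover have "(\<lambda>n. exp (- (\<epsilon> / 4 * real n))) \<longlonglongrightarrow> 0"
    using \<epsilon> by real_asymp
  ultimately have up: "(\<lambda>n. exp (- (\<epsilon> / 4 * real n)) + measure \<mu> (D (n - k))) \<longlonglongrightarrow> 0"
    using tendsto_add[of "\<lambda>n. exp (- (\<epsilon> / 4 * real n))" 0] by simp
  show ?thesis
  proof (rule tendsto_sandwich[OF _ _ tendsto_const up])
    show "\<forall>\<^sub>F n in sequentially. measure \<mu> {x. word_prob (word 0 n x) < exp (- ((h + \<epsilon>) * real n))}
        \<le> exp (- (\<epsilon> / 4 * real n)) + measure \<mu> (D (n - k))"
      using main unfolding eventually_sequentially by blast
  qed simp
qed

end

subsection \<open>The density flow\<close>

text \<open>A two-part code: half of the weight is uniform on the words of \<open>G\<close>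
  compatible with \<open>y\<close>, half is the uniform law on \<open>A\<close>, used outside
  \<open>G\<close>. The halves are the origin of \<open>ln 2\<close>.\<close>

lemma (in prob_space) part_entropy_count_le:
  assumes X: "simple_function M X" and Y: "simple_function M Y"
    and A: "finite A" "X ` space M \<subseteq> A"
  shows "part_entropy M X \<le> part_entropy M Y + ln 2
    + (\<integral>x. (if X x \<in> G then ln (real (card {w \<in> G. \<exists>z\<in>space M. Y z = Y x \<and> X z = w}))
         else ln (real (card A))) \<partial>M)"
proof -
  define D where "D y = {w \<in> G. \<exists>z\<in>space M. Y z = y \<and> X z = w}" for y
  have D: "finite (D y)" "D y \<subseteq> X ` space M" for y
    using A by (auto simp: D_def intro: finite_subset[of _ A])
  have "X ` space M \<noteq> {}" using not_empty by simp
  then have cA: "0 < card A" using A by (auto simp: card_gt_0_iff)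
  have cD: "0 < card (D (Y x))" if "x \<in> space M" "X x \<in> G" for x
    using that D(1)[of "Y x"] by (auto simp: card_gt_0_iff D_def)
  define m where "m w y = (if w \<in> G then real (card (D y)) else real (card A))" for w y
  define q where "q w y = (if w \<in> G \<longrightarrow> w \<in> D y then 1 / (2 * m w y) else 0)" for w y
  have in_D: "X x \<in> D (Y x)" if "x \<in> space M" "X x \<in> G" for x using that by (auto simp: D_def)
  have m_pos: "0 < m (X x) (Y x)" if "x \<in> space M" for x
    using cD[OF that] cA by (simp add: m_def)
  have Z: "simple_function M (\<lambda>x. (X x, Y x))" using X Y by (rule simple_function_Pair)
  have "part_entropy M X \<le> part_entropy M (\<lambda>x. (X x, Y x))"
    by (rule part_entropy_mono[OF Z X]) simp
  also have "\<dots> \<le> part_entropy M Y + (\<integral>x. - ln (q (X x) (Y x)) \<partial>M)"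
  proof (rule part_entropy_pair_le[OF X Y])
    show "0 \<le> q w y" for w y by (simp add: q_def m_def)
    show "AE x in M. 0 < q (X x) (Y x)"
      using m_pos in_D by (intro AE_I2) (simp add: q_def)
    fix y
    have "(\<Sum>w\<in>X ` space M. q w y)
        \<le> (\<Sum>w\<in>X ` space M. (if w \<in> D y then 1 / (2 * real (card (D y))) else 0) + 1 / (2 * real (card A)))"
      by (intro sum_mono) (auto simp: q_def m_def D_def)
    also have "\<dots> = real (card (D y)) / (2 * real (card (D y))) + real (card (X ` space M)) / (2 * real (card A))"
      using D A(2) finite_subset[OF A(2,1)] by (simp add: sum.distrib sum.If_cases Int_absorb1)
    also have "\<dots> \<le> 1 / 2 + 1 / 2"
      using card_mono[OF A] cA by (intro add_mono) (auto simp: divide_simps)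
    finally show "(\<Sum>w\<in>X ` space M. q w y) \<le> 1" by simp
  qed
  also have "(\<integral>x. - ln (q (X x) (Y x)) \<partial>M) = (\<integral>x. ln 2 + ln (m (X x) (Y x)) \<partial>M)"
  proof (rule Bochner_Integration.integral_cong[OF refl])
    fix x assume x: "x \<in> space M"
    then show "- ln (q (X x) (Y x)) = ln 2 + ln (m (X x) (Y x))"
      using m_pos[OF x] in_D[OF x] by (simp add: q_def ln_div ln_mult)
  qed
  also have "\<dots> = ln 2 + (\<integral>x. ln (m (X x) (Y x)) \<partial>M)"
    using integrable_simple_comp[OF Z, of "\<lambda>z. ln (case_prod m z)"] by (simp add: prob_space)
  also have "(\<integral>x. ln (m (X x) (Y x)) \<partial>M)
      = (\<integral>x. (if X x \<in> G then ln (real (card (D (Y x)))) else ln (real (card A))) \<partial>M)"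
    by (intro Bochner_Integration.integral_cong) (auto simp: m_def)
  finally show ?thesis unfolding D_def by simp
qed

section \<open>Windows of a speed that is constant in space\<close>

context config_system
begin

context
  fixes gp gm :: "nat \<Rightarrow> nat" and p :: nat
begin

abbreviation "Gp \<equiv> \<lambda>n (_::'a config). gp n"
abbreviation "Gm \<equiv> \<lambda>n (_::'a config). gm n"

text \<open>The size of \<open>Jset\<close>. It exceeds \<open>Gsize\<close> by the margin
  \<open>2 * p\<close>, which vanishes after division by \<open>n\<close>.\<close>

definition wlen :: "nat \<Rightarrow> nat" where
  "wlen n = gp n + gm n + 2 * p + 1"

definition wstart :: "nat \<Rightarrow> int" where
  "wstart n = - int (gp n) - int p"

abbreviation "wword n \<equiv> word (wstart n) (wlen n)"

lemma Jset_eq: "Jset Gp Gm p n x = {wstart n..<wstart n + int (wlen n)}"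
  by (auto simp: Jset_def wstart_def wlen_def)

lemma wword_eq_iff: "wword n x = wword n y \<longleftrightarrow> (\<forall>j\<in>Jset Gp Gm p n z. x j = y j)"
  by (simp add: word_eq_iff Jset_eq)

lemma measure_Galpha: "measure \<mu> (Galpha Gp Gm p n x) = word_prob (wword n x)"
proof -
  have "Galpha Gp Gm p n x = wword n -` {wword n x}"
    by (auto simp: Galpha_def cyl_def wword_eq_iff[of n _ _ x])
  then show ?thesis by (simp add: word_prob_word fibre_prob_def)
qed

lemma info_rate_cong:
  "wword n x = wword n y \<Longrightarrow> info_rate \<mu> Gp Gm p n x = info_rate \<mu> Gp Gm p n y"
  by (simp add: info_rate_def measure_Galpha Gsize_def)

lemma Xset_cong:
  assumes "wword n x = wword n y" shows "x \<in> Xset \<mu> Gp Gm p n \<delta> \<longleftrightarrow> y \<in> Xset \<mu> Gp Gm p n \<delta>"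
  unfolding Xset_def using info_rate_cong[OF assms] by simp

lemma Xset_sets: "Xset \<mu> Gp Gm p n \<delta> \<in> sets \<mu>"
proof (rule depends_on_sets)
  show "depends_on {wstart n..<wstart n + int (wlen n)} (\<lambda>x. x \<in> Xset \<mu> Gp Gm p n \<delta>)"
    unfolding depends_on_def word_eq_iff[symmetric] using Xset_cong by blast
qed simp

text \<open>The deviation takes only finitely many values, so an \<open>\<epsilon>\<close> admissible for \<open>\<eta>\<close> and below the
  smallest value exceeding \<open>\<eta>\<close> already bounds it on \<open>X\<close>.\<close>

lemma measure_Xset:
  assumes "0 < \<delta>" shows "1 - \<delta> \<le> measure \<mu> (Xset \<mu> Gp Gm p n \<delta>)"
proof (cases "Xset \<mu> Gp Gm p n \<delta> = UNIV")
  case True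
  then show ?thesis using assms prob_space by simp
next
  case False
  let ?X = "Xset \<mu> Gp Gm p n \<delta>"
  define e where "e x = \<bar>info_rate \<mu> Gp Gm p n x - real_of_ereal (ks_entropy \<mu> shift)\<bar>" for x
  have "simple_function \<mu> e"
  proof (rule simple_function_depends_on[of "{wstart n..<wstart n + int (wlen n)}"])
    show "depends_on {wstart n..<wstart n + int (wlen n)} e"
      unfolding depends_on_def word_eq_iff[symmetric] e_def using info_rate_cong by metis
  qed simp
  then have "finite (range e)" by (simp add: simple_function_def)
  then have fin: "finite (e ` (- ?X))" by (rule finite_subset[rotated]) auto
  \<comment> \<open>The minimum exists because \<open>X\<close> is not everything here; an infinite
    \<eta> belongs to the other case.\<close>
  define m where "m = Min (e ` (- ?X))"
  have "m \<in> e ` (- ?X)" unfolding m_def using fin False by (intro Min_in) auto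
  then have "eta \<mu> Gp Gm p n \<delta> < ereal m" by (auto simp: Xset_def e_def not_le)
  then obtain \<epsilon> S where S: "\<epsilon> < m" "S \<in> sets \<mu>" "1 - \<delta> \<le> measure \<mu> S"
      "\<And>x i. x \<in> S \<Longrightarrow> n \<le> i \<Longrightarrow> \<bar>info_rate \<mu> Gp Gm p i x - real_of_ereal (ks_entropy \<mu> shift)\<bar> < \<epsilon>"
    unfolding eta_def Inf_less_iff by auto
  have "S \<subseteq> ?X"
  proof (rule subsetI, rule ccontr)
    fix x assume "x \<in> S" "x \<notin> ?X"
    then have "m \<le> e x" unfolding m_def using fin by (intro Min_le) auto
    moreover have "e x < \<epsilon>" unfolding e_def using S(4)[OF \<open>x \<in> S\<close> order_refl] .
    ultimately show False using S(1) by simp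
  qed
  then have "measure \<mu> S \<le> measure \<mu> ?X" by (intro finite_measure_mono Xset_sets)
  with S(3) show ?thesis by simp
qed

text \<open>Here \<open>c\<close> caps the information in the denominator. Words of \<open>G\<close>
  respect the cap and are coded by rank, while the remaining points, of probability at most \<delta>
  plus that of breaking the cap, are coded by plain letters. Positive block entropy keeps the
  denominators from vanishing on words of positive probability.\<close>

lemma Mnpd_upper:
  fixes F :: "'a config \<Rightarrow> 'a config"
  assumes F: "measure_preserving \<mu> F"
    and \<xi>: "fin_partition \<mu> \<xi>" "\<And>x y. \<xi> x = \<xi> y \<longleftrightarrow> (\<forall>j\<in>{- int p..int p}. x j = y j)"
    and \<delta>: "0 < \<delta>" and c: "0 < c" and H: "0 < part_entropy \<mu> (word 0 (wlen n))"
  shows "Mnpd \<mu> F Gp Gm n p \<delta>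
    \<le> 1 - (part_entropy \<mu> (word 0 (wlen n)) - part_entropy \<mu> (itinerary F \<xi> (Suc n)) - ln 2
        - (\<delta> + measure \<mu> {x. word_prob (word 0 (wlen n) x) < exp (- c)}) * (real (wlen n) * ln (real CARD('a)))) / c"
proof -
  interpret F: mp_system \<mu> F by unfold_locales (rule F)
  let ?W = "wword n" and ?L = "wlen n"
  let ?X = "Xset \<mu> Gp Gm p n \<delta>"
  let ?T = "Tdelta_words \<mu> F Gp Gm p n \<delta>"
  let ?J = "{wstart n..<wstart n + int ?L}"
  define Y where "Y = itinerary F \<xi> (Suc n)"
  define I where "I x = - ln (word_prob (?W x))" for x
  have Y: "simple_function \<mu> Y" unfolding Y_def by (rule F.itinerary_simple[OF \<xi>(1)])
  note W = word_simple[of "wstart n" ?L]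
  \<comment> \<open>Times 0 to \<open>n\<close> inclusive, hence an itinerary of length
    \<open>Suc n\<close>.\<close>
  have Falpha: "Falpha F p n x = {z. Y z = Y x}" for x
  proof -
    have "Y z = Y x \<longleftrightarrow> (\<forall>i\<in>{..n}. \<forall>j\<in>{- int p..int p}. (F ^^ i) z j = (F ^^ i) x j)" for z
      by (simp add: Y_def itinerary_def \<xi>(2) atLeast0LessThan lessThan_Suc_atMost del: upt_Suc)
    then show ?thesis by (auto simp: Falpha_def abs_le_iff)
  qed
  define B where "B = {x. word_prob (?W x) < exp (- c)}"
  define G where "G = ?W ` (?X - B)"
  have G_iff: "?W x \<in> G \<longleftrightarrow> x \<in> ?X - B" for x
  proof
    assume "?W x \<in> G"
    then obtain z where "?W x = ?W z" "z \<in> ?X - B" by (auto simp: G_def)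
    then show "x \<in> ?X - B" using Xset_cong[of n x z \<delta>] by (auto simp: B_def)
  qed (auto simp: G_def)
  define D where "D x = {w \<in> G. \<exists>z\<in>space \<mu>. Y z = Y x \<and> ?W z = w}" for x
  have T_fin: "finite (?T x)" for x
    by (rule finite_subset[of _ "?J \<rightarrow>\<^sub>E UNIV"]) (auto simp: Tdelta_words_def Jset_eq intro!: finite_PiE)
  \<comment> \<open>Elements of \<open>D x\<close> are lists and those of \<open>?T x\<close>
    restricted functions; reading the window turns the latter into the former, so cardinalities
    compare.\<close>
  have "D x \<subseteq> ?W ` ?T x" for x
  proof
    fix w assume "w \<in> D x"
    then obtain z where z: "Y z = Y x" "?W z = w" "w \<in> G" by (auto simp: D_def)
    then have "z \<in> ?X" using G_iff[of z] by auto
    then have "restrict z ?J \<in> ?T x"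
      using z(1) by (auto simp: Tdelta_words_def Tset_def Twords_def Falpha Jset_eq)
    moreover have "?W (restrict z ?J) = w" unfolding z(2)[symmetric] by (simp add: word_eq_iff)
    ultimately show "w \<in> ?W ` ?T x" by blast
  qed
  then have D_le: "card (D x) \<le> card (?T x)" for x
    using T_fin surj_card_le[of "?T x" "D x" ?W] by simp
  have D_pos: "0 < card (D x)" if "?W x \<in> G" for x
  proof -
    have "finite (D x)" using W by (auto simp: D_def simple_function_def intro: finite_subset[of _ "range ?W"])
    moreover have "?W x \<in> D x" using that by (auto simp: D_def)
    ultimately show ?thesis by (auto simp: card_gt_0_iff)
  qed
  \<comment> \<open>Zero information would mean a word of probability 1, hence zero block entropy,
    against \<open>H\<close>.\<close>
  have I_pos: "0 < I x" if "0 < word_prob (?W x)" for x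
  proof (rule ccontr)
    assume "\<not> 0 < I x"
    moreover have "word_prob (?W x) \<le> 1" by (simp add: word_prob_def)
    ultimately have "word_prob (?W x) = 1" using that by (simp add: I_def)
    then have "measure \<mu> (?W -` {?W x} \<inter> space \<mu>) = 1" by (simp add: word_prob_word fibre_prob_def)
    then have "AE z in \<mu>. z \<in> ?W -` {?W x} \<inter> space \<mu>"
      using simple_function_fibre_sets[OF W] by (simp add: prob_eq_1)
    then have "AE z in \<mu>. - ln (word_prob (?W z)) = 0"
      by eventually_elim (use \<open>word_prob (?W x) = 1\<close> in auto)
    then have "(\<integral>z. - ln (word_prob (?W z)) \<partial>\<mu>) = (\<integral>z. 0 \<partial>\<mu>)"
      by (intro integral_cong_AE simple_function_measurable_comp[OF W, of "\<lambda>w. - ln (word_prob w)"]) auto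
    then have "part_entropy \<mu> ?W = 0"
      by (simp add: part_entropy_eq_integral[OF W] word_prob_word)
    with H show False by (simp add: part_entropy_word[of "wstart n"])
  qed
  have I_nonneg: "0 \<le> I x" for x
    by (cases "word_prob (?W x) = 0") (auto simp: I_def word_prob_def ln_le_zero_iff order.strict_iff_order)
  define u where "u x = (if ?W x \<in> G then ln (real (card (D x))) else 0)" for x
  \<comment> \<open>On \<open>G\<close> the denominator is positive and at most \<open>c\<close>.
    Off \<open>G\<close> the left side is 0 and the right side nonnegative, also in the degenerate
    cases \<open>ln 0 = 0\<close> and division by 0.\<close>
  have u_le: "u x / c \<le> ln (real (card (?T x))) / I x" for x
  proof (cases "?W x \<in> G")
    case True
    then have "exp (- c) \<le> word_prob (?W x)" using G_iff[of x] by (simp add: B_def)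
    then have pos: "0 < word_prob (?W x)" by (rule less_le_trans[rotated]) simp
    have "- c \<le> ln (word_prob (?W x))" using pos \<open>exp (- c) \<le> _\<close> by (simp add: ln_ge_iff)
    then have Ic: "I x \<le> c" by (simp add: I_def)
    have "u x \<le> ln (real (card (?T x)))"
      using D_le[of x] D_pos[OF True] True by (simp add: u_def)
    moreover have "0 \<le> u x" using D_pos[OF True] True by (simp add: u_def)
    ultimately show ?thesis using Ic I_pos[OF pos] by (intro frac_le) auto
  next
    case False
    have "0 \<le> ln (real (card (?T x)))" by (cases "card (?T x)") auto
    then show ?thesis using False I_nonneg[of x] by (simp add: u_def)
  qed
  have Z: "simple_function \<mu> (\<lambda>x. (?W x, Y x))" using W Y by (rule simple_function_Pair)
  have u_int: "integrable \<mu> u"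
    using integrable_simple_comp[OF Z, of "\<lambda>(w, y). if w \<in> G
      then ln (real (card {w \<in> G. \<exists>z\<in>space \<mu>. Y z = y \<and> ?W z = w})) else 0"]
    unfolding u_def[abs_def] D_def by simp
  \<comment> \<open>The integrand depends on the point only through its word and its itinerary, so
    it takes finitely many values.\<close>
  have M_int: "integrable \<mu> (\<lambda>x. 1 - ln (real (card (?T x))) / I x)"
    using integrable_simple_comp[OF Z, of "\<lambda>(w, y). 1 - ln (real (card ((\<lambda>z. restrict z ?J) `
      ({z. restrict z ?J \<in> (\<lambda>z. restrict z ?J) ` {z. Y z = y}} \<inter> ?X)))) / - ln (word_prob w)"]
    by (simp add: Tdelta_words_def Tset_def Twords_def Falpha Jset_eq I_def)
  have GS: "{x. ?W x \<notin> G} \<in> sets \<mu>"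
    using simple_function_fibre_sets[OF W, of "- G"] by (simp add: vimage_def)
  have BS: "B \<in> sets \<mu>"
    using simple_function_fibre_sets[OF W, of "{w. word_prob w < exp (- c)}"] by (simp add: vimage_def B_def)
  have "measure \<mu> {x. ?W x \<notin> G} \<le> measure \<mu> ((UNIV - ?X) \<union> B)"
    using BS Xset_sets[of n \<delta>] sets.compl_sets[OF Xset_sets[of n \<delta>]] G_iff
    by (intro finite_measure_mono) auto
  also have "\<dots> \<le> measure \<mu> (UNIV - ?X) + measure \<mu> B"
    using BS sets.compl_sets[OF Xset_sets[of n \<delta>]] by (intro measure_Un_le) auto
  also have "measure \<mu> (UNIV - ?X) \<le> \<delta>"
    using prob_compl[OF Xset_sets[of n \<delta>]] measure_Xset[OF \<delta>, of n] by simp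
  also have "B = {x. (\<lambda>w. word_prob w < exp (- c)) (?W x)}" by (simp add: B_def)
  also have "measure \<mu> \<dots> = measure \<mu> {x. word_prob (word 0 ?L x) < exp (- c)}"
    by (rule measure_word)
  finally have bad: "measure \<mu> {x. ?W x \<notin> G} \<le> \<delta> + measure \<mu> {x. word_prob (word 0 ?L x) < exp (- c)}"
    by simp
  let ?A = "{w::'a list. length w = ?L}"
  have cardA: "ln (real (card ?A)) = real ?L * ln (real CARD('a))"
    using card_lists_length_eq[of "UNIV :: 'a set" ?L] by (simp add: ln_realpow)
  have lA: "0 \<le> real ?L * ln (real CARD('a))" by (simp add: Suc_leI card_gt_0_iff)
  have "part_entropy \<mu> ?W \<le> part_entropy \<mu> Y + ln 2
      + (\<integral>x. (if ?W x \<in> G then ln (real (card (D x))) else ln (real (card ?A))) \<partial>\<mu>)"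
    unfolding D_def by (rule part_entropy_count_le[OF W Y]) auto
  also have "(\<integral>x. (if ?W x \<in> G then ln (real (card (D x))) else ln (real (card ?A))) \<partial>\<mu>)
      = (\<integral>x. u x + indicator {x. ?W x \<notin> G} x * (real ?L * ln (real CARD('a))) \<partial>\<mu>)"
    by (intro Bochner_Integration.integral_cong) (auto simp: u_def cardA)
  also have "\<dots> = (\<integral>x. u x \<partial>\<mu>) + measure \<mu> {x. ?W x \<notin> G} * (real ?L * ln (real CARD('a)))"
    using u_int GS by (subst Bochner_Integration.integral_add)
      (auto intro!: integrable_mult_left integrable_real_indicator simp: emeasure_eq_measure)
  also have "measure \<mu> {x. ?W x \<notin> G} * (real ?L * ln (real CARD('a)))
      \<le> (\<delta> + measure \<mu> {x. word_prob (word 0 ?L x) < exp (- c)}) * (real ?L * ln (real CARD('a)))"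
    using bad lA by (rule mult_right_mono)
  finally have low: "part_entropy \<mu> (word 0 ?L) - part_entropy \<mu> Y - ln 2
      - (\<delta> + measure \<mu> {x. word_prob (word 0 ?L x) < exp (- c)}) * (real ?L * ln (real CARD('a)))
      \<le> (\<integral>x. u x \<partial>\<mu>)"
    by (simp add: part_entropy_word[of "wstart n"])
  have "Mnpd \<mu> F Gp Gm n p \<delta> = (\<integral>x. 1 - ln (real (card (?T x))) / I x \<partial>\<mu>)"
    by (simp add: Mnpd_def measure_Galpha I_def)
  also have "\<dots> \<le> (\<integral>x. 1 - u x / c \<partial>\<mu>)"
    using u_le u_int by (intro integral_mono M_int) auto
  also have "\<dots> = 1 - (\<integral>x. u x \<partial>\<mu>) / c"
    using u_int prob_space by simp
  finally show ?thesis using divide_right_mono[OF low, of c] c unfolding Y_def by linarith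
qed

end

text \<open>The cap is taken as \<open>(h + \<epsilon>) * L\<close>, which is broken with vanishing
  probability. For fixed \<epsilon> the limits in \<open>n\<close> and then in \<delta> are those of
  the definition; \<epsilon> is auxiliary and goes to 0 last.\<close>

lemma Limsup_Mnpd_le:
  fixes F :: "'a config \<Rightarrow> 'a config" and gp gm :: "nat \<Rightarrow> nat"
  assumes erg: "ergodic \<mu> shift" and F: "measure_preserving \<mu> F"
    and \<xi>: "fin_partition \<mu> \<xi>" "\<And>x y. \<xi> x = \<xi> y \<longleftrightarrow> (\<forall>j\<in>{- int p..int p}. x j = y j)"
    and h: "0 < h" "(\<lambda>n. part_entropy \<mu> (word 0 n) / real n) \<longlonglongrightarrow> h"
      "\<And>n. 0 < n \<Longrightarrow> h \<le> part_entropy \<mu> (word 0 n) / real n"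
    and v: "0 < v" "(\<lambda>n. real (gp n + gm n) / real n) \<longlonglongrightarrow> v"
  shows "Limsup (at_right 0) (\<lambda>\<delta>. Limsup sequentially (\<lambda>n. ereal (Mnpd \<mu> F (\<lambda>n _. gp n) (\<lambda>n _. gm n) n p \<delta>)))
    \<le> ereal (entropy_rel \<mu> F \<xi> / (v * h))"
proof -
  interpret F: mp_system \<mu> F by unfold_locales (rule F)
  let ?M = "\<lambda>n \<delta>. Mnpd \<mu> F (\<lambda>n _. gp n) (\<lambda>n _. gm n) n p \<delta>"
  let ?H = "\<lambda>n. part_entropy \<mu> (itinerary F \<xi> n)"
  let ?E = "entropy_rel \<mu> F \<xi>" and ?lA = "ln (real CARD('a))"
  define L where "L n = wlen gp gm p n" for n
  have L_pos: "0 < L n" for n by (simp add: L_def wlen_def)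
  have Ln: "(\<lambda>n. real (L n) / real n) \<longlonglongrightarrow> v"
  proof -
    have "(\<lambda>n. real (gp n + gm n) / real n + real (2 * p + 1) / real n) \<longlonglongrightarrow> v + 0"
      by (intro tendsto_add v(2) lim_const_over_n)
    then show ?thesis by (simp add: L_def wlen_def add_divide_distrib[symmetric] algebra_simps)
  qed
  have L_top: "filterlim (\<lambda>n. real (L n)) at_top sequentially"
  proof -
    have "filterlim (\<lambda>n. real (L n) / real n * real n) at_top sequentially"
      using filterlim_tendsto_pos_mult_at_top[OF Ln v(1) filterlim_real_sequentially] .
    then show ?thesis
      by (rule filterlim_mono_eventually) (auto simp: eventually_sequentially intro!: exI[of _ 1])
  qed
  then have L_top': "filterlim L at_top sequentially"
    by (simp add: filterlim_sequentially_iff_filterlim_real)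
  have bound: "Limsup (at_right 0) (\<lambda>\<delta>. Limsup sequentially (\<lambda>n. ereal (?M n \<delta>)))
      \<le> ereal (1 - h / (h + \<epsilon>) + ?E / (v * (h + \<epsilon>)))" if \<epsilon>: "0 < \<epsilon>" for \<epsilon>
  proof -
    define b where "b n = measure \<mu> {x. word_prob (word 0 (L n) x) < exp (- ((h + \<epsilon>) * real (L n)))}" for n
    have b: "b \<longlonglongrightarrow> 0"
      unfolding b_def[abs_def]
      using filterlim_compose[OF word_prob_lower[OF erg less_imp_le[OF h(1)] h(2) \<epsilon>] L_top'] .
    \<comment> \<open>The bound of \<open>Mnpd_upper\<close> with \<open>H(W)\<close> lowered to
      \<open>h * L\<close>, rearranged so that every factor is a quotient with a known limit. The
      term \<open>H(Y) / L\<close> is split because the itinerary has \<open>n + 1\<close> letters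
      and the window about \<open>v * n\<close>.\<close>
    define R where "R \<delta> n = 1 - h / (h + \<epsilon>) + ?H (Suc n) / real (Suc n) * (real (Suc n) / real n) / (real (L n) / real n) / (h + \<epsilon>)
        + ln 2 / (h + \<epsilon>) / real (L n) + (\<delta> + b n) * ?lA / (h + \<epsilon>)" for \<delta> n
    have M_le: "?M n \<delta> \<le> R \<delta> n" if \<delta>: "0 < \<delta>" and n: "0 < n" for \<delta> n
    proof -
      let ?l = "real (L n)" and ?W = "part_entropy \<mu> (word 0 (L n))"
      have W: "h * ?l \<le> ?W" using h(3)[OF L_pos[of n]] L_pos[of n] by (simp add: pos_le_divide_eq)
      have "0 < h * ?l" using h(1) L_pos by simp
      with W have "0 < ?W" by linarith
      then have "?M n \<delta> \<le> 1 - (?W - ?H (Suc n) - ln 2 - (\<delta> + b n) * (?l * ?lA)) / ((h + \<epsilon>) * ?l)"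
        using Mnpd_upper[OF F \<xi> \<delta>, of "(h + \<epsilon>) * ?l" gp gm n] h(1) \<epsilon> L_pos[of n]
        by (simp add: L_def[symmetric] b_def)
      also have "\<dots> \<le> 1 - (h * ?l - ?H (Suc n) - ln 2 - (\<delta> + b n) * (?l * ?lA)) / ((h + \<epsilon>) * ?l)"
        using W h(1) \<epsilon> by (intro diff_left_mono divide_right_mono) auto
      also have "\<dots> = R \<delta> n"
      proof -
        have "0 < h + \<epsilon>" "0 < ?l" "0 < real n" "0 < real (Suc n)" using h(1) \<epsilon> L_pos n by auto
        then have "?H (Suc n) / real (Suc n) * (real (Suc n) / real n) / (?l / real n) = ?H (Suc n) / ?l"
          by (simp del: of_nat_Suc)
        moreover have "1 - (h * l - x - y - d * (l * a)) / (k * l) = 1 - h / k + x / l / k + y / k / l + d * a / k"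
          if "0 < k" "0 < l" for k l x y d a :: real
          using that by (simp add: diff_divide_distrib)
        ultimately show ?thesis unfolding R_def using \<open>0 < h + \<epsilon>\<close> \<open>0 < ?l\<close> by metis
      qed
      finally show ?thesis .
    qed
    have R_lim: "R \<delta> \<longlonglongrightarrow> 1 - h / (h + \<epsilon>) + ?E * 1 / v / (h + \<epsilon>) + 0 + (\<delta> + 0) * ?lA / (h + \<epsilon>)" for \<delta>
      unfolding R_def[abs_def]
    proof (intro tendsto_intros b Ln tendsto_divide_0[OF tendsto_const])
      show "(\<lambda>n. ?H (Suc n) / real (Suc n)) \<longlonglongrightarrow> ?E" by (rule LIMSEQ_Suc[OF F.entropy_rel_limit(1)[OF \<xi>(1)]])
      show "(\<lambda>n. real (Suc n) / real n) \<longlonglongrightarrow> 1" by real_asymp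
      show "filterlim (\<lambda>n. real (L n)) at_infinity sequentially"
        using L_top by (rule filterlim_at_top_imp_at_infinity)
    qed (use v h \<epsilon> in auto)
    have inner: "Limsup sequentially (\<lambda>n. ereal (?M n \<delta>))
        \<le> ereal (1 - h / (h + \<epsilon>) + ?E / (v * (h + \<epsilon>)) + \<delta> * ?lA / (h + \<epsilon>))" if "0 < \<delta>" for \<delta>
    proof -
      have "Limsup sequentially (\<lambda>n. ereal (?M n \<delta>)) \<le> Limsup sequentially (\<lambda>n. ereal (R \<delta> n))"
        using M_le[OF that] by (intro Limsup_mono) (auto simp: eventually_sequentially intro!: exI[of _ 1])
      also have "\<dots> = ereal (1 - h / (h + \<epsilon>) + ?E * 1 / v / (h + \<epsilon>) + 0 + (\<delta> + 0) * ?lA / (h + \<epsilon>))"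
        using R_lim[of \<delta>] by (intro lim_imp_Limsup) auto
      finally show ?thesis by simp
    qed
    have "Limsup (at_right 0) (\<lambda>\<delta>. Limsup sequentially (\<lambda>n. ereal (?M n \<delta>)))
        \<le> Limsup (at_right 0) (\<lambda>\<delta>. ereal (1 - h / (h + \<epsilon>) + ?E / (v * (h + \<epsilon>)) + \<delta> * ?lA / (h + \<epsilon>)))"
      by (intro Limsup_mono eventually_at_right_less[THEN eventually_mono] inner)
    also have "\<dots> = ereal (1 - h / (h + \<epsilon>) + ?E / (v * (h + \<epsilon>)) + 0 * ?lA / (h + \<epsilon>))"
      using h(1) \<epsilon> by (intro lim_imp_Limsup tendsto_intros) auto
    finally show ?thesis by simp
  qed
  \<comment> \<open>The left side of \<open>bound\<close> does not involve \<epsilon>, so its right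
    side may be taken to the limit, where \<open>1 - h / h\<close> disappears.\<close>
  have "((\<lambda>\<epsilon>. ereal (1 - h / (h + \<epsilon>) + ?E / (v * (h + \<epsilon>))))
      \<longlongrightarrow> ereal (1 - h / (h + 0) + ?E / (v * (h + 0)))) (at_right 0)"
    using h(1) v(1) by (intro tendsto_intros) auto
  then have "((\<lambda>\<epsilon>. ereal (1 - h / (h + \<epsilon>) + ?E / (v * (h + \<epsilon>)))) \<longlongrightarrow> ereal (?E / (v * h))) (at_right 0)"
    using h(1) by simp
  then show ?thesis
    by (rule tendsto_lowerbound)
      (intro eventually_at_right_less[THEN eventually_mono] bound, simp_all)
qed

end

section \<open>Linear speeds and the final inequality\<close>

lemma ceiling_mult_over_n:
  assumes "0 \<le> (v::real)"
  shows "(\<lambda>n. real (nat \<lceil>v * real n\<rceil>) / real n) \<longlonglongrightarrow> v"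
proof (rule tendsto_sandwich)
  show "(\<lambda>n. v) \<longlonglongrightarrow> v" by simp
  show "(\<lambda>n. v + 1 / real n) \<longlonglongrightarrow> v"
    using tendsto_add[OF tendsto_const lim_const_over_n[of 1], of v] by simp
  have eq: "real (nat \<lceil>v * real n\<rceil>) = real_of_int \<lceil>v * real n\<rceil>" for n
    using assms by simp
  have up: "real_of_int \<lceil>v * real n\<rceil> \<le> 1 + v * real n" for n by linarith
  show "\<forall>\<^sub>F n in sequentially. v \<le> real (nat \<lceil>v * real n\<rceil>) / real n"
    unfolding eq eventually_sequentially
    by (intro exI[of _ 1]) (auto simp: pos_le_divide_eq)
  show "\<forall>\<^sub>F n in sequentially. real (nat \<lceil>v * real n\<rceil>) / real n \<le> v + 1 / real n"
    unfolding eq eventually_sequentially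
    by (intro exI[of _ 1]) (auto simp: field_simps up)
qed

theorem theorem2:
  fixes \<mu> :: "('a::finite) config measure"
    and r :: nat and f :: "'a list \<Rightarrow> 'a"
    and vp vm :: real
  assumes "prob_space \<mu>"
    and "sets \<mu> = sets config_space"
    and "ergodic \<mu> shift"
    and "measure_preserving \<mu> (ca r f)"
    and "vp \<ge> 0" and "vm \<ge> 0"
  shows "ks_entropy \<mu> (ca r f) \<ge>
           ks_entropy \<mu> shift * ereal (vp + vm) * density_flow_v \<mu> (ca r f) vp vm"
proof -
  interpret prob_space \<mu> by (rule assms(1))
  interpret config_system \<mu>
    using assms(2,3) by unfold_locales (auto simp: ergodic_def)
  let ?F = "ca r f"
  interpret F: mp_system \<mu> ?F by unfold_locales (rule assms(4))
  obtain h where h: "ks_entropy \<mu> shift = ereal h" "0 \<le> h"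
    "(\<lambda>n. part_entropy \<mu> (word 0 n) / real n) \<longlonglongrightarrow> h"
    "\<And>n. 0 < n \<Longrightarrow> h \<le> part_entropy \<mu> (word 0 n) / real n"
    by (rule ks_entropy_shift) (rule that; assumption)
  have rel_le: "ereal (entropy_rel \<mu> ?F \<xi>) \<le> ks_entropy \<mu> ?F" if "fin_partition \<mu> \<xi>" for \<xi>
    unfolding ks_entropy_def using that by (intro SUP_upper) simp
  \<comment> \<open>The empty window gives the trivial partition, which suffices to see that the
    supremum is nonnegative.\<close>
  obtain \<xi>0 where \<xi>0: "fin_partition \<mu> \<xi>0"
    by (rule obtain_window_partition[OF finite.emptyI])
  have "0 \<le> ereal (entropy_rel \<mu> ?F \<xi>0)" using F.entropy_rel_nonneg[OF \<xi>0] by simp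
  also have "\<dots> \<le> ks_entropy \<mu> ?F" by (rule rel_le[OF \<xi>0])
  finally have nonneg: "0 \<le> ks_entropy \<mu> ?F" .
  let ?v = "vp + vm"
  show ?thesis
  proof (cases "h = 0 \<or> ?v = 0")
    \<comment> \<open>The product is 0 even if the density flow is infinite, since
      \<open>0 * \<infinity> = 0\<close> in \<open>ereal\<close>.\<close>
    case True
    then have "ks_entropy \<mu> shift * ereal ?v * density_flow_v \<mu> ?F vp vm = 0"
      by (auto simp: h(1) zero_ereal_def[symmetric])
    with nonneg show ?thesis by (simp only:)
  next
    case False
    with h(2) assms(5,6) have pos: "0 < h" "0 < ?v" by auto
    show ?thesis
    \<comment> \<open>Infinite entropy makes the claim trivial and nonnegativity excludes the value
      minus infinity, so the division by \<open>?v * h\<close> takes place among reals.\<close>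
    proof (cases "ks_entropy \<mu> ?F")
      case (real k)
      let ?gp = "\<lambda>n. nat \<lceil>vp * real n\<rceil>" and ?gm = "\<lambda>n. nat \<lceil>vm * real n\<rceil>"
      have lim: "(\<lambda>n. real (?gp n + ?gm n) / real n) \<longlonglongrightarrow> ?v"
        using tendsto_add[OF ceiling_mult_over_n[OF assms(5)] ceiling_mult_over_n[OF assms(6)]]
        unfolding of_nat_add add_divide_distrib .
      have "density_flow_v \<mu> ?F vp vm \<le> ereal (k / (?v * h))"
        unfolding density_flow_v_def density_flow_def
      proof (rule SUP_least)
        fix p :: nat
        obtain \<xi> where \<xi>: "fin_partition \<mu> \<xi>" "\<And>x y. \<xi> x = \<xi> y \<longleftrightarrow> (\<forall>j\<in>{- int p..int p}. x j = y j)"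
          using obtain_window_partition[of "{- int p..int p}"] finite_atLeastAtMost_int by metis
        have "entropy_rel \<mu> ?F \<xi> \<le> k" using rel_le[OF \<xi>(1)] real by simp
        then have "ereal (entropy_rel \<mu> ?F \<xi> / (?v * h)) \<le> ereal (k / (?v * h))"
          using pos by (simp add: divide_right_mono)
        with Limsup_Mnpd_le[OF assms(3,4) \<xi> pos(1) h(3,4) pos(2) lim]
        show "Limsup (at_right 0) (\<lambda>\<delta>. Limsup sequentially
            (\<lambda>n. ereal (Mnpd \<mu> ?F (\<lambda>n _. ?gp n) (\<lambda>n _. ?gm n) n p \<delta>))) \<le> ereal (k / (?v * h))"
          by (rule order_trans)
      qed
      then have "ereal (h * ?v) * density_flow_v \<mu> ?F vp vm \<le> ereal (h * ?v) * ereal (k / (?v * h))"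
        using pos by (intro ereal_mult_left_mono) auto
      also have "\<dots> = ereal k"
      proof -
        have "?v * h \<noteq> 0" using pos by simp
        then have "?v * h * k / (?v * h) = k" by (rule nonzero_mult_div_cancel_left)
        then show ?thesis
          by (simp only: times_ereal.simps(1) mult.commute[of h] times_divide_eq_right)
      qed
      finally show ?thesis using real by (simp add: h(1))
    qed (use nonneg in auto)
  qed
qed

end
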